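(* Let $m\ge 2$ be an integer and let $f:[-1,1]^2\to\mathbb{R}$ be a continuous function such that the kernel $((x,z),(y,w))\in(S^1\times S^m)^2\mapsto f(x\cdot y,z\cdot w)$ is positive definite. Let $J_f=\{(k,l)\in\mathbb{Z}_+^2 : a_{k,l}^{1,m}>0\}$, where $a_{k,l}^{1,m}$ are the coefficients of $f$ in its series representation (see context). If $$\big\{k : \{l : (k,l)\in J_f\}\in \mathrm{SPD}(S^m)\big\}\in\mathrm{SPD}(S^1),$$ then the kernel $((x,z),(y,w))\in(S^1\times S^m)^2\mapsto f(x\cdot y,z\cdot w)$ is strictly positive definite on $S^1\times S^m$.
   Context: $S^d$ is the unit sphere of $\mathbb{R}^{d+1}$, $\cdot$ is the usual inner product and $\mathbb{Z}_+=\{0,1,2,\ldots\}$. A kernel $K:X\times X\to\mathbb{R}$ on a nonempty set $X$ is positive definite if $K(u,v)=K(v,u)$ for all $u,v$ and $\sum_{\mu,\nu=1}^n c_\mu c_\nu K(u_\mu,u_\nu)\ge0$ for all $n\ge1$, all distinct $u_1,\ldots,u_n\in X$ and all real $c_1,\ldots,c_n$; it is strictly positive definite if moreover these inequalities are strict whenever at least one $c_\mu$ is nonzero. Polynomials: $P_0^1\equiv1$ and $P_k^1(\cos\theta)=\frac{2}{k}\cos k\theta$ for $k\ge1$; for $d\ge2$, $P_l^d$ is the Gegenbauer polynomial of degree $l$ attached to the number $(d-1)/2$, normalized by $P_l^d(1)=\binom{l+d-2}{l}$. Series representations (known facts): (a) a continuous $g:[-1,1]\to\mathbb{R}$ gives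 a positive definite kernel $(z,w)\mapsto g(z\cdot w)$ on $S^d$ ($d\ge1$) if and only if $g(t)=\sum_{l=0}^\infty a_l^dP_l^d(t)$ with $a_l^d\ge0$ and $\sum_l a_l^dP_l^d(1)<\infty$. (b) A continuous $f:[-1,1]^2\to\mathbb{R}$ gives a positive definite kernel $((x,z),(y,w))\mapsto f(x\cdot y,z\cdot w)$ on $S^1\times S^m$ if and only if $f(t,s)=\sum_{k,l=0}^\infty a_{k,l}^{1,m}P_k^1(t)P_l^m(s)$, with $a_{k,l}^{1,m}\ge0$ and $\sum_{k,l}a_{k,l}^{1,m}P_k^1(1)P_l^m(1)<\infty$. In both cases the coefficients are determined by the function. For $I\subset\mathbb{Z}_+$ and $d\ge1$, write $I\in\mathrm{SPD}(S^d)$ if there exists a continuous $g:[-1,1]\to\mathbb{R}$ such that $(z,w)\in(S^d)^2\mapsto g(z\cdot w)$ is strictly positive definite and the set $\{l : a_l^d>0\}$ attached to $g$ by (a) is precisely $I$. (Strict positive definiteness of such a kernel depends only on the set $\{l : a_l^d>0\}$, not on the actual values of the coefficients.) *)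

theory Defs
  imports "HOL-Analysis.Analysis"
begin

definition pos_def_on :: "'a set \<Rightarrow> ('a \<Rightarrow> 'a \<Rightarrow> real) \<Rightarrow> bool" where
  "pos_def_on X K \<longleftrightarrow>
     (\<forall>u\<in>X. \<forall>v\<in>X. K u v = K v u) \<and>
     (\<forall>n\<ge>1. \<forall>(u :: nat \<Rightarrow> 'a) (c :: nat \<Rightarrow> real).
        u ` {1..n} \<subseteq> X \<and> inj_on u {1..n} \<longrightarrow>
        (\<Sum>i=1..n. \<Sum>j=1..n. c i * c j * K (u i) (u j)) \<ge> 0)"

definition strictly_pos_def_on :: "'a set \<Rightarrow> ('a \<Rightarrow> 'a \<Rightarrow> real) \<Rightarrow> bool" where
  "strictly_pos_def_on X K \<longleftrightarrow>
     pos_def_on X K \<and>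
     (\<forall>n\<ge>1. \<forall>(u :: nat \<Rightarrow> 'a) (c :: nat \<Rightarrow> real).
        u ` {1..n} \<subseteq> X \<and> inj_on u {1..n} \<and> (\<exists>i\<in>{1..n}. c i \<noteq> 0) \<longrightarrow>
        (\<Sum>i=1..n. \<Sum>j=1..n. c i * c j * K (u i) (u j)) > 0)"

text \<open>Gegenbauer polynomials \<open>C\<^sub>l\<^sup>\<lambda>\<close> by their three-term recurrence
  \<open>n C\<^sub>n(t) = 2 (n + \<lambda> - 1) t C\<^sub>n\<^sub>-\<^sub>1(t) - (n + 2\<lambda> - 2) C\<^sub>n\<^sub>-\<^sub>2(t)\<close>, with \<open>n = l + 2\<close> below.\<close>

fun gegenbauer :: "real \<Rightarrow> nat \<Rightarrow> real \<Rightarrow> real" where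
  "gegenbauer lam 0 t = 1"
| "gegenbauer lam (Suc 0) t = 2 * lam * t"
| "gegenbauer lam (Suc (Suc l)) t =
     (2 * (real l + 1 + lam) * t * gegenbauer lam (Suc l) t
       - (real l + 2 * lam) * gegenbauer lam l t) / (real l + 2)"

text \<open>\<open>P\<^sub>l\<^sup>d\<close>, meaningful for \<open>d \<ge> 1\<close> and arguments in \<open>[-1,1]\<close>.\<close>

definition sphere_poly :: "nat \<Rightarrow> nat \<Rightarrow> real \<Rightarrow> real" where
  "sphere_poly d l t =
     (if d = 1 then (if l = 0 then 1 else 2 / real l * cos (real l * arccos t))
      else gegenbauer ((real d - 1) / 2) l t)"

lemma gegenbauer_at_1: "gegenbauer lam l 1 = pochhammer (2 * lam) l / fact l"
proof (induction l rule: induct_nat_012)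
  case (ge2 n)
  have "fact n \<noteq> (0::real)" by simp
  have e: "pochhammer (2*lam) (Suc n) = pochhammer (2*lam) n * (2*lam + n)"
     "pochhammer (2*lam) (Suc (Suc n)) = pochhammer (2*lam) n * (2*lam + n) * (2*lam + n + 1)"
    by (simp_all add: pochhammer_Suc)
  have nz: "real n + 2 \<noteq> 0" "real n + 1 \<noteq> 0" by linarith+
  have fa: "fact (Suc (Suc n)) = (real n + 2) * (real n + 1) * fact n"
    "fact (Suc n) = (real n + 1) * (fact n :: real)"
    by (simp_all add: algebra_simps)
  show ?case
    unfolding gegenbauer.simps ge2.IH e fa using nz by (simp add: divide_simps) algebra
qed simp_all

lemma sphere_poly_at_1:
  assumes "d \<ge> 2"
  shows "sphere_poly d l 1 = real ((l + d - 2) choose l)"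
proof -
  have "sphere_poly d l 1 = pochhammer (real d - 1) l / fact l"
    using assms by (simp add: sphere_poly_def gegenbauer_at_1 diff_divide_distrib)
  also have "\<dots> = (real (l + d - 2)) gchoose l"
    using assms by (simp add: gbinomial_pochhammer' of_nat_diff algebra_simps)
  finally show ?thesis by (simp add: binomial_gbinomial)
qed

lemma sphere_poly_circle:
  assumes "k \<ge> 1"
  shows "sphere_poly 1 k (cos \<theta>) = 2 / real k * cos (real k * \<theta>)"
proof -
  define \<phi> where "\<phi> = arccos (cos \<theta>)"
  have "cos \<phi> = cos \<theta>" by (simp add: \<phi>_def)
  then obtain n :: int where "\<phi> = \<theta> + 2 * of_int n * pi \<or> \<phi> = - \<theta> + 2 * of_int n * pi"
    unfolding cos_eq by (auto elim!: Ints_cases)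
  then have "real k * \<phi> = real k * \<theta> + 2 * of_int (int k * n) * pi \<or>
             real k * \<phi> = - (real k * \<theta>) + 2 * of_int (int k * n) * pi"
    by (elim disj_forward) (simp_all only: of_int_mult of_int_of_nat_eq, simp_all only: distrib_left mult_ac mult_minus_right)
  then have "cos (real k * \<phi>) = cos (real k * \<theta>)"
    unfolding cos_eq by (metis Ints_of_int)
  then show ?thesis
    using assms by (simp add: sphere_poly_def \<phi>_def)
qed

definition sphere_coeffs :: "nat \<Rightarrow> (real \<Rightarrow> real) \<Rightarrow> (nat \<Rightarrow> real) \<Rightarrow> bool" where
  "sphere_coeffs d g a \<longleftrightarrow>
     (\<forall>l. a l \<ge> 0) \<and>
     summable (\<lambda>l. a l * sphere_poly d l 1) \<and>
     (\<forall>t\<in>{-1..1}. (\<lambda>l. a l * sphere_poly d l t) sums g t)"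

definition product_coeffs :: "nat \<Rightarrow> (real \<Rightarrow> real \<Rightarrow> real) \<Rightarrow> (nat \<Rightarrow> nat \<Rightarrow> real) \<Rightarrow> bool" where
  "product_coeffs m f a \<longleftrightarrow>
     (\<forall>k l. a k l \<ge> 0) \<and>
     (\<lambda>(k, l). a k l * sphere_poly 1 k 1 * sphere_poly m l 1) summable_on UNIV \<and>
     (\<forall>t\<in>{-1..1}. \<forall>s\<in>{-1..1}.
        ((\<lambda>(k, l). a k l * sphere_poly 1 k t * sphere_poly m l s) has_sum f t s) UNIV)"

text \<open>By Schoenberg's theorem and its analogue for products of spheres, a continuous function
  inducing a positive definite kernel has exactly one coefficient family, so the existential
  quantifier in the next two definitions just names that family.\<close>

definition sphere_support :: "nat \<Rightarrow> (real \<Rightarrow> real) \<Rightarrow> nat set" where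
  "sphere_support d g = {l. \<exists>a. sphere_coeffs d g a \<and> a l > 0}"

definition product_support :: "nat \<Rightarrow> (real \<Rightarrow> real \<Rightarrow> real) \<Rightarrow> (nat \<times> nat) set" where
  "product_support m f = {(k, l). \<exists>a. product_coeffs m f a \<and> a k l > 0}"

text \<open>\<open>SPD_sphere TYPE('n)\<close> is \<open>SPD(S\<^sup>d)\<close> for the unit sphere \<open>S\<^sup>d\<close> of \<open>real^'n\<close>, that is, with
  \<open>d = CARD('n) - 1\<close>; it is meant for \<open>CARD('n) \<ge> 2\<close>.\<close>

definition SPD_sphere :: "'n::finite itself \<Rightarrow> nat set set" where
  "SPD_sphere _ =
     {I. \<exists>g :: real \<Rightarrow> real.
           continuous_on {-1..1} g \<and>
           strictly_pos_def_on (sphere (0 :: real^'n) 1) (\<lambda>z w. g (z \<bullet> w)) \<and>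
           sphere_support (CARD('n) - 1) g = I}"

end

theory Submission
  imports Defs "HOL-Probability.Probability_Measure"
begin

text \<open>If the quadratic form of the kernel with weights \<open>c\<close> vanishes at points \<open>(x, z)\<close>, then so does that of
  every \<open>P\<^sub>k(x \<bullet> y) P\<^sub>l(z \<bullet> w)\<close> with \<open>(k, l)\<close> in the support. Since \<open>P\<^sub>k(x \<bullet> y)\<close> is a positive multiple of
  \<open>cos k\<theta> cos k\<theta>' + sin k\<theta> sin k\<theta>'\<close>, it splits into two nonnegative forms in \<open>P\<^sub>l\<close> alone, and strictness on
  \<open>S\<^sup>m\<close> shows that the weights \<open>c cos k\<theta>\<close> and \<open>c sin k\<theta>\<close> sum to zero over the points with a common \<open>z\<close>.
  Strictness on \<open>S\<^sup>1\<close> then gives \<open>c = 0\<close> on each such fibre.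

  Membership in \<open>SPD(S\<^sup>d)\<close> can only be exploited through an expansion of the witness, hence both the positive
  definiteness of \<open>P\<^sub>l\<close> and the existence half of Schoenberg's theorem are needed. With respect to the rotation invariant
  measure, the convolution of two zonal polynomials is a zonal polynomial of no larger degree, so by orthogonality
  \<open>P\<^sub>l * P\<^sub>l\<close> is a positive multiple of \<open>P\<^sub>l\<close>; this makes \<open>P\<^sub>l\<close> positive definite and the coefficients of a positive
  definite function nonnegative. Testing against \<open>((1 + t) / 2)\<^sup>N\<close> bounds the sum of the coefficients by the value at \<open>1\<close>,
  and completeness identifies the sum of the series.\<close>

section \<open>Normalized Gegenbauer polynomials\<close>

text \<open>The Gegenbauer polynomial divided by its value at 1 (the Chebyshev polynomial for
  \<open>d = 1\<close>), with the recurrence rescaled accordingly. As a \<open>poly\<close> it has a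
  degree and a derivative, and one family covers the circle and the higher spheres.\<close>

fun zonal :: "nat \<Rightarrow> nat \<Rightarrow> real poly" where
  "zonal d 0 = 1"
| "zonal d (Suc 0) = [:0, 1:]"
| "zonal d (Suc (Suc l)) = smult (1 / real (l + d))
     (smult (real (2 * l + d + 1)) ([:0, 1:] * zonal d (Suc l)) - smult (real (l + 1)) (zonal d l))"

lemma smult_real: "smult (real n) p = of_nat n * p"
  by (simp add: of_nat_poly)

lemma zonal_rec:
  assumes "d \<ge> 1"
  shows "of_nat (l + d) * zonal d (Suc (Suc l)) =
    of_nat (2 * l + d + 1) * ([:0, 1:] * zonal d (Suc l)) - of_nat (l + 1) * zonal d l"
proof -
  have "smult (real (l + d)) (zonal d (Suc (Suc l))) =
    smult (real (2 * l + d + 1)) ([:0, 1:] * zonal d (Suc l)) - smult (real (l + 1)) (zonal d l)"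
    using assms unfolding zonal.simps smult_smult by simp
  then show ?thesis
    unfolding smult_real .
qed

text \<open>The two ladder relations are proved together: the step for the first one differentiates
  the three-term recurrence and uses both to eliminate the derivatives. The first one later enters
  the computation of means.\<close>

lemma zonal_deriv:
  assumes d: "d \<ge> 1"
  shows "(1 - [:0, 1:]\<^sup>2) * pderiv (zonal d (Suc l)) =
           of_nat (l + 1) * (zonal d l - [:0, 1:] * zonal d (Suc l)) \<and>
         (1 - [:0, 1:]\<^sup>2) * pderiv (zonal d l) =
           (of_nat l + of_nat d - 1) * ([:0, 1:] * zonal d l - zonal d (Suc l))"
proof (induction l)
  case 0
  show ?case
    by (simp add: pderiv_pCons one_pCons[symmetric] power2_eq_square)
next
  case (Suc l)
  define X :: "real poly" where "X = [:0, 1:]"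
  define L D :: "real poly" where "L = of_nat l" and "D = of_nat d"
  define A B C where "A = zonal d l" and "B = zonal d (Suc l)" and "C = zonal d (Suc (Suc l))"
  have X': "pderiv X = 1"
    by (simp add: X_def pderiv_pCons)
  have rec: "(L + D) * C = (2 * L + D + 1) * (X * B) - (L + 1) * A"
    using zonal_rec[OF d, of l] by (simp add: A_def B_def C_def X_def L_def D_def add_ac)
  have LD: "pderiv (L + D) = 0" "pderiv (2 * L + D + 1) = 0" "pderiv (L + 1) = 0"
    unfolding L_def D_def by (simp_all add: pderiv_add pderiv_mult pderiv_of_nat)
  have rec': "(L + D) * pderiv C = (2 * L + D + 1) * (B + X * pderiv B) - (L + 1) * pderiv A"
    using arg_cong[OF rec, of pderiv] unfolding pderiv_mult pderiv_diff LD X'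
    by (simp add: algebra_simps)
  have IH: "(1 - X\<^sup>2) * pderiv B = (L + 1) * (A - X * B)"
     "(1 - X\<^sup>2) * pderiv A = (L + D - 1) * (X * A - B)"
    using Suc by (simp_all add: A_def B_def X_def L_def D_def)
  have nz: "L + D \<noteq> 0"
    using d unfolding L_def D_def by (metis add_is_0 not_one_le_zero of_nat_add of_nat_eq_0_iff)
  have "(L + D) * ((1 - X\<^sup>2) * pderiv C) =
      (2 * L + D + 1) * ((1 - X\<^sup>2) * B + X * ((1 - X\<^sup>2) * pderiv B)) - (L + 1) * ((1 - X\<^sup>2) * pderiv A)"
    using rec' by algebra
  also have "\<dots> = (L + D) * ((L + 2) * (B - X * C))"
    using rec unfolding IH by algebra
  finally have 1: "(1 - X\<^sup>2) * pderiv C = (L + 2) * (B - X * C)"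
    using nz by simp
  have 2: "(1 - X\<^sup>2) * pderiv B = (L + D) * (X * B - C)"
    using rec unfolding IH by algebra
  show ?case
    using 1 2 unfolding A_def B_def C_def X_def L_def D_def by (simp add: add_ac)
qed

lemma degree_zonal_le: "degree (zonal d l) \<le> l"
proof (induction l rule: induct_nat_012)
  case (ge2 n)
  have "degree ([:0, 1:] * zonal d (Suc n)) \<le> Suc (Suc n)"
    using degree_mult_le[of "[:0, 1:]" "zonal d (Suc n)"] ge2 by simp
  moreover have "degree (smult c (zonal d n)) \<le> Suc (Suc n)" for c
    using degree_smult_le[of c "zonal d n"] ge2 by linarith
  ultimately show ?case
    unfolding zonal.simps smult_diff_right smult_smult
    by (intro degree_diff_le) (auto intro: order.trans[OF degree_smult_le])
qed auto

lemma lead_zonal_pos: "d \<ge> 1 \<Longrightarrow> coeff (zonal d l) l > 0"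
proof (induction l rule: induct_nat_012)
  case (ge2 n)
  have "coeff (zonal d n) (Suc (Suc n)) = 0"
    using degree_zonal_le[of d n] by (intro coeff_eq_0) linarith
  then show ?case
    using ge2 by simp
qed auto

lemma zonal_at_1: "d \<ge> 1 \<Longrightarrow> poly (zonal d l) 1 = 1"
proof (induction l rule: induct_nat_012)
  case (ge2 n)
  then show ?case by (simp add: field_simps)
qed auto

text \<open>Induction on the degree bound: a multiple of the top zonal polynomial, whose leading
  coefficient is positive, removes the coefficient of \<open>q\<close> in degree
  \<open>Suc n\<close>.\<close>

lemma poly_in_zonal_span:
  assumes d: "d \<ge> 1" and "degree q \<le> n"
  shows "\<exists>b. q = (\<Sum>j\<le>n. smult (b j) (zonal d j))"
  using assms(2)
proof (induction n arbitrary: q)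
  case 0
  then obtain c where "q = [:c:]"
    by (metis degree_eq_zeroE le_zero_eq)
  then show ?case by (intro exI[of _ "\<lambda>_. c"]) simp
next
  case (Suc n)
  define c where "c = coeff q (Suc n) / coeff (zonal d (Suc n)) (Suc n)"
  have "degree (q - smult c (zonal d (Suc n))) \<le> n"
  proof (rule degree_le, intro allI impI)
    fix i assume "n < i"
    then consider "i = Suc n" | "i > Suc n" by linarith
    then show "coeff (q - smult c (zonal d (Suc n))) i = 0"
    proof cases
      case 1
      then show ?thesis
        using lead_zonal_pos[OF d, of "Suc n"] by (simp add: c_def)
    next
      case 2
      then have "coeff q i = 0" "coeff (zonal d (Suc n)) i = 0"
        using Suc.prems degree_zonal_le[of d "Suc n"] by (simp_all add: coeff_eq_0)
      then show ?thesis by simp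
    qed
  qed
  then obtain b where b: "q - smult c (zonal d (Suc n)) = (\<Sum>j\<le>n. smult (b j) (zonal d j))"
    using Suc.IH by blast
  then have "q = (\<Sum>j\<le>n. smult (b j) (zonal d j)) + smult c (zonal d (Suc n))"
    by (metis diff_add_cancel)
  then show ?case
    by (intro exI[of _ "b(Suc n := c)"]) simp
qed

text \<open>For \<open>d = 1\<close> the addition formula for the cosine gives the recurrence of
  \<open>zonal 1\<close>, with \<open>cos (arccos t) = t\<close> on the given range. Otherwise the
  Gegenbauer recurrence is divided by the values at 1 from \<open>gegenbauer_at_1\<close>.\<close>

lemma sphere_poly_zonal:
  assumes d: "d \<ge> 1" and t: "t \<in> {-1..1}"
  shows "sphere_poly d l t = sphere_poly d l 1 * poly (zonal d l) t"
proof (cases "d = 1")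
  case True
  have "cos (real l * arccos t) = poly (zonal 1 l) t"
  proof (induction l rule: induct_nat_012)
    case 1
    then show ?case using t by simp
  next
    case (ge2 n)
    define \<theta> where "\<theta> = arccos t"
    have t': "t = cos \<theta>" using t by (simp add: \<theta>_def)
    have e: "real (Suc (Suc n)) * \<theta> = real (Suc n) * \<theta> + \<theta>" "real n * \<theta> = real (Suc n) * \<theta> - \<theta>"
      by (simp_all add: algebra_simps)
    have "cos (real (Suc (Suc n)) * \<theta>) = 2 * cos \<theta> * cos (real (Suc n) * \<theta>) - cos (real n * \<theta>)"
      unfolding e cos_add cos_diff by simp
    moreover have "poly (zonal 1 (Suc (Suc n))) t = 2 * t * poly (zonal 1 (Suc n)) t - poly (zonal 1 n) t"
      by (simp add: field_simps)
    ultimately show ?case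
      using ge2 t' unfolding \<theta>_def[symmetric] by simp
  qed simp
  then show ?thesis
    using True t by (simp add: sphere_poly_def)
next
  case False
  define lam where "lam = (real d - 1) / 2"
  have lam: "lam > 0" "real d = 2 * lam + 1" using d False by (auto simp: lam_def field_simps)
  have "gegenbauer lam l t = gegenbauer lam l 1 * poly (zonal d l) t"
  proof (induction l rule: induct_nat_012)
    case (ge2 n)
    define g where "g = pochhammer (2 * lam) n / fact n"
    have p: "pochhammer (2 * lam) (Suc n) = pochhammer (2*lam) n * (2*lam + n)"
        "pochhammer (2 * lam) (Suc (Suc n)) = pochhammer (2*lam) n * (2*lam + n) * (2*lam + n + 1)"
      by (simp_all add: pochhammer_Suc)
    have f: "fact (Suc n) = (real n + 1) * (fact n :: real)"
        "fact (Suc (Suc n)) = (real n + 2) * (real n + 1) * (fact n :: real)"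
      by (simp_all add: algebra_simps)
    have g: "gegenbauer lam n 1 = g" "gegenbauer lam (Suc n) 1 = g * (2 * lam + n) / (real n + 1)"
      "gegenbauer lam (Suc (Suc n)) 1 = g * (2 * lam + n) * (2 * lam + n + 1) / ((real n + 1) * (real n + 2))"
      unfolding gegenbauer_at_1 p f g_def times_divide_times_eq times_divide_eq_left divide_divide_eq_left
      by (simp_all only: mult_ac add_ac)
    define a b where "a = poly (zonal d n) t" and "b = poly (zonal d (Suc n)) t"
    have nz: "2 * lam + n \<noteq> 0" "2 * lam + n + 1 \<noteq> 0" "real n + 1 \<noteq> 0" "real n + 2 \<noteq> 0"
      using lam(1) by (smt (verit) of_nat_0_le_iff)+
    have z: "poly (zonal d (Suc (Suc n))) t =
       ((2 * n + 2 * lam + 2) * (t * b) - (n + 1) * a) / (2 * lam + n + 1)"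
      by (simp add: a_def b_def lam(2) add_ac)
    have "gegenbauer lam (Suc (Suc n)) t =
       (2 * (real n + 1 + lam) * t * (g * (2 * lam + n) / (real n + 1) * b) - (real n + 2 * lam) * (g * a)) / (real n + 2)"
      using ge2 unfolding g a_def[symmetric] b_def[symmetric] by simp
    also have "\<dots> = g * (2 * lam + n) * (2 * lam + n + 1) / ((real n + 1) * (real n + 2)) *
        (((2 * n + 2 * lam + 2) * (t * b) - (n + 1) * a) / (2 * lam + n + 1))"
      using nz by (simp add: divide_simps) (simp add: algebra_simps)
    finally show ?case
      unfolding g(3) z .
  qed auto
  then show ?thesis
    using False by (simp add: sphere_poly_def lam_def)
qed

lemma sphere_poly_at_1_pos: "d \<ge> 1 \<Longrightarrow> sphere_poly d l 1 > 0"
  using sphere_poly_at_1[of d l] by (cases "d = 1") (simp_all add: sphere_poly_def)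

section \<open>Rotation invariant measure on the sphere\<close>

text \<open>By Vitali's theorem an open set is, up to a null set, a disjoint union of balls,
  whose volume does not depend on the centre.\<close>

lemma lborel_open_le_vimage:
  fixes f :: "'a::euclidean_space \<Rightarrow> 'a"
  assumes f: "orthogonal_transformation f" and U: "open U"
  shows "emeasure lborel U \<le> emeasure lborel (f -` U)"
proof -
  define g where "g = inv f"
  have fg: "f (g x) = x" for x
    using f by (simp add: g_def orthogonal_transformation_surj surj_f_inv_f)
  \<comment> \<open>An isometry pulls balls back to balls of the same radius, hence of the same
    volume.\<close>
  have vim: "f -` ball c r = ball (g c) r" for c r
  proof -
    have "dist c (f x) = dist (g c) x" for x
      using f fg[of c] unfolding orthogonal_transformation_isometry by metis
    then show ?thesis by auto
  qed
  have cont: "continuous_on UNIV f"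
    using f by (simp add: linear_continuous_on orthogonal_transformation_linear linear_linear)
  define K where "K = {(x, r). r > 0 \<and> ball x r \<subseteq> U}"
  obtain C where C: "countable C" "C \<subseteq> K"
      "pairwise (\<lambda>i j. disjnt (ball (fst i) (snd i)) (ball (fst j) (snd j))) C"
      "negligible (U - (\<Union>i \<in> C. ball (fst i) (snd i)))"
  proof (rule Vitali_covering_theorem_balls[of U K fst snd])
    fix x and d :: real assume "x \<in> U" "0 < d"
    then obtain e where "e > 0" "ball x e \<subseteq> U"
      using U by (meson openE)
    then have "(x, min e (d/2)) \<in> K"
      using \<open>0 < d\<close> by (auto simp: K_def)
    then show "\<exists>i. i \<in> K \<and> x \<in> ball (fst i) (snd i) \<and> snd i < d"
      using \<open>0 < d\<close> \<open>e > 0\<close> by (intro exI[of _ "(x, min e (d/2))"]) auto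
  qed
  define B where "B = (\<Union>i\<in>C. ball (fst i) (snd i))"
  have disj: "disjoint_family_on (\<lambda>i. ball (fst i) (snd i)) C"
    using C(3) by (auto simp: disjoint_family_on_def pairwise_def disjnt_def)
  have "open B"
    unfolding B_def by (intro open_UN ballI open_ball)
  then have B: "B \<in> sets lborel" and Us: "U \<in> sets lborel"
    using U by simp_all
  have BU: "B \<subseteq> U"
    unfolding B_def
  proof (rule UN_least)
    fix i assume "i \<in> C"
    then have "i \<in> K" using C(2) by blast
    then show "ball (fst i) (snd i) \<subseteq> U" by (cases i) (simp add: K_def)
  qed
  have N: "U - B \<in> null_sets lborel"
    using C(4) sets.Diff[OF Us B] unfolding B_def negligible_iff_null_sets
    by (simp add: null_sets_completion_iff)
  have "emeasure lborel U = emeasure lborel B"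
    using emeasure_Un_null_set[OF B N] BU by (simp add: Un_absorb1)
  also have "\<dots> = (\<integral>\<^sup>+i. emeasure lborel (ball (fst i) (snd i)) \<partial>count_space C)"
    unfolding B_def using C(1) disj by (intro emeasure_UN_countable) auto
  also have "\<dots> = (\<integral>\<^sup>+i. emeasure lborel (f -` ball (fst i) (snd i)) \<partial>count_space C)"
    using C(2) by (intro nn_integral_cong) (auto simp: vim emeasure_ball K_def)
  also have "\<dots> = emeasure lborel (\<Union>i\<in>C. f -` ball (fst i) (snd i))"
  proof (rule emeasure_UN_countable[symmetric])
    show "disjoint_family_on (\<lambda>i. f -` ball (fst i) (snd i)) C"
      using disj by (simp add: disjoint_family_on_def vimage_Int[symmetric] del: vimage_Int)
  qed (use C(1) in \<open>auto simp: vim\<close>)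
  also have "\<dots> \<le> emeasure lborel (f -` U)"
  proof (rule emeasure_mono)
    show "f -` U \<in> sets lborel"
      using open_vimage[OF U cont] by simp
  qed (use BU in \<open>auto simp: B_def\<close>)
  finally show ?thesis .
qed

text \<open>The inequality for \<open>f\<close> and for its inverse gives equality on open sets.
  These are stable under intersection and generate the Borel sets, and the balls about 0 exhaust the
  space with finite measure.\<close>

lemma lborel_distr_orthogonal:
  fixes f :: "'a::euclidean_space \<Rightarrow> 'a"
  assumes f: "orthogonal_transformation f"
  shows "distr lborel borel f = lborel"
proof -
  define g where "g = inv f"
  have g: "orthogonal_transformation g"
    using f by (simp add: g_def orthogonal_transformation_inv)
  have cont: "continuous_on UNIV f"
    using f by (simp add: linear_continuous_on orthogonal_transformation_linear linear_linear)
  then have meas [measurable]: "f \<in> borel_measurable borel"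
    by (rule borel_measurable_continuous_onI)
  have eq: "emeasure lborel (f -` U) = emeasure lborel U" if U: "open U" for U
  proof (rule antisym)
    have "emeasure lborel (f -` U) \<le> emeasure lborel (g -` f -` U)"
      using open_vimage[OF U cont] by (rule lborel_open_le_vimage[OF g])
    also have "g -` f -` U = U"
      using f by (auto simp: g_def orthogonal_transformation_surj surj_f_inv_f)
    finally show "emeasure lborel (f -` U) \<le> emeasure lborel U" .
  qed (rule lborel_open_le_vimage[OF f U])
  show ?thesis
  proof (rule measure_eqI_generator_eq[where E = "Collect open" and \<Omega> = UNIV and A = "\<lambda>n. ball 0 (real n)"])
    show "Int_stable (Collect (open :: 'a set \<Rightarrow> bool))"
      by (auto simp: Int_stable_def)
    show "(\<Union>i. ball (0::'a) (real i)) = UNIV"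
      using reals_Archimedean2 by auto
    show "emeasure (distr lborel borel f) (ball 0 (real i)) \<noteq> \<infinity>" for i
      by (simp add: emeasure_distr eq emeasure_ball)
    show "emeasure (distr lborel borel f) X = emeasure lborel X" if "X \<in> Collect open" for X
      using that by (simp add: emeasure_distr eq)
  qed (auto simp: borel_def)
qed

section \<open>Normalized surface measure of the sphere\<close>

definition unit_ball_measure :: "'a::euclidean_space measure" where
  "unit_ball_measure = uniform_measure lborel (ball 0 1)"

text \<open>The default at 0 is an arbitrary unit vector, so that the map takes values in the sphere
  everywhere; the origin is a null set.\<close>

definition unit_direction :: "'a::euclidean_space \<Rightarrow> 'a" where
  "unit_direction v = (if v = 0 then SOME b. b \<in> Basis else sgn v)"

text \<open>Normalized volume of the ball pushed forward along radial projection. This is normalized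
  surface measure, and rotation invariance is inherited from Lebesgue measure.\<close>

definition sphere_measure :: "'a::euclidean_space measure" where
  "sphere_measure = distr unit_ball_measure (restrict_space borel (sphere 0 1)) unit_direction"

lemma norm_unit_direction [simp]: "norm (unit_direction v) = 1"
  by (simp add: unit_direction_def norm_sgn norm_Basis[OF someI_ex] ex_in_conv)

lemma sets_unit_ball_measure [simp, measurable_cong]: "sets unit_ball_measure = sets borel"
  and space_unit_ball_measure [simp]: "space unit_ball_measure = UNIV"
  by (simp_all add: unit_ball_measure_def)

lemma unit_ball_lborel:
  "emeasure lborel (ball (0::'a::euclidean_space) 1) \<noteq> 0" "emeasure lborel (ball (0::'a) 1) \<noteq> \<infinity>"
  using unit_ball_vol_pos[of "real DIM('a)"] by (simp_all add: emeasure_ball del: unit_ball_vol_pos)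

lemma unit_direction_measurable [measurable]:
  "unit_direction \<in> measurable borel (restrict_space borel (sphere 0 1))"
proof (rule measurable_restrict_space2)
  show "unit_direction \<in> borel_measurable borel"
    unfolding unit_direction_def[abs_def] sgn_div_norm by measurable
qed simp

lemma prob_space_unit_ball_measure: "prob_space unit_ball_measure"
  unfolding unit_ball_measure_def using unit_ball_lborel by (rule prob_space_uniform_measure)

lemma prob_space_sphere_measure: "prob_space sphere_measure"
  unfolding sphere_measure_def
  by (rule prob_space.prob_space_distr[OF prob_space_unit_ball_measure]) measurable

lemma sets_sphere_measure [simp, measurable_cong]:
    "sets sphere_measure = sets (restrict_space borel (sphere 0 1))"
  and space_sphere_measure [simp]: "space sphere_measure = sphere 0 1"
  by (simp_all add: sphere_measure_def space_restrict_space)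

lemma borel_measurable_sphere_measure_id: "(\<lambda>x. x) \<in> borel_measurable sphere_measure"
  using measurable_restrict_space1[OF measurable_ident_sets[OF refl], of borel "sphere (0::'a::euclidean_space) 1"]
  by (simp cong: measurable_cong_sets)

lemma sets_sphere_measure_open:
  assumes "open U"
  shows "U \<inter> sphere 0 1 \<in> sets sphere_measure"
proof -
  have "sphere 0 1 \<inter> U \<in> (\<inter>) (sphere 0 1) ` sets borel"
    using assms by (intro imageI) simp
  then show ?thesis
    unfolding sets_sphere_measure sets_restrict_space by (simp only: Int_commute)
qed

lemma integrable_sphere_measure:
  fixes F :: "'a::euclidean_space \<Rightarrow> real"
  assumes "continuous_on (sphere 0 1) F"
  shows "integrable sphere_measure F"
proof -
  interpret prob_space sphere_measure by (rule prob_space_sphere_measure)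
  have "bounded (F ` sphere 0 1)"
    using assms by (intro compact_imp_bounded compact_continuous_image) auto
  then obtain b where "\<forall>x\<in>sphere 0 1. norm (F x) \<le> b"
    by (auto simp: bounded_iff)
  moreover have "F \<in> borel_measurable sphere_measure"
    using borel_measurable_continuous_on_restrict[OF assms]
    by (simp cong: measurable_cong_sets)
  ultimately show ?thesis
    by (intro integrable_const_bound[of _ b]) auto
qed

lemma AE_unit_ball_measure_nonzero: "AE v in unit_ball_measure. v \<noteq> (0::'a::euclidean_space)"
  unfolding unit_ball_measure_def
  by (intro AE_uniform_measureI) (auto intro: AE_I[of _ _ "{0}"])

lemma unit_ball_measure_orthogonal:
  fixes f :: "'a::euclidean_space \<Rightarrow> 'a"
  assumes f: "orthogonal_transformation f"
  shows "distr unit_ball_measure borel f = unit_ball_measure"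
proof (rule measure_eqI)
  fix A assume "A \<in> sets (distr unit_ball_measure borel f)"
  then have A [measurable]: "A \<in> sets borel" by simp
  have [measurable]: "f \<in> borel_measurable borel"
    using f by (intro borel_measurable_continuous_onI)
      (simp add: linear_continuous_on orthogonal_transformation_linear linear_linear)
  have "ball 0 1 \<inter> f -` A = f -` (ball 0 1 \<inter> A)"
    using f by (auto simp: orthogonal_transformation_norm)
  moreover have "emeasure lborel (f -` (ball 0 1 \<inter> A)) = emeasure lborel (ball 0 1 \<inter> A)"
    by (subst (2) lborel_distr_orthogonal[OF f, symmetric]) (simp add: emeasure_distr)
  moreover have "f -` A \<in> sets borel"
    using measurable_sets[of f borel borel A] by simp
  ultimately show "emeasure (distr unit_ball_measure borel f) A = emeasure unit_ball_measure A"
    by (simp add: emeasure_distr) (simp add: unit_ball_measure_def)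
qed simp

lemma integral_sphere_orthogonal:
  fixes F :: "'a::euclidean_space \<Rightarrow> real" and f :: "'a \<Rightarrow> 'a"
  assumes f: "orthogonal_transformation f" and F: "continuous_on (sphere 0 1) F"
  shows "(\<integral>w. F (f w) \<partial>sphere_measure) = (\<integral>w. F w \<partial>sphere_measure)"
proof -
  have f_cont: "continuous_on A f" for A
    using f by (simp add: linear_continuous_on orthogonal_transformation_linear linear_linear)
  then have [measurable]: "f \<in> borel_measurable borel"
    by (intro borel_measurable_continuous_onI)
  have [measurable]: "F \<in> borel_measurable (restrict_space borel (sphere 0 1))"
    using F by (rule borel_measurable_continuous_on_restrict)
  have "continuous_on (sphere 0 1) (\<lambda>w. F (f w))"
    using f by (intro continuous_on_compose2[OF F f_cont]) (auto simp: orthogonal_transformation_norm)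
  then have [measurable]: "(\<lambda>w. F (f w)) \<in> borel_measurable (restrict_space borel (sphere 0 1))"
    by (rule borel_measurable_continuous_on_restrict)
  \<comment> \<open>At the origin the two sides may differ because of the arbitrary default
    direction, hence the almost-everywhere comparison below.\<close>
  have comm: "f (unit_direction v) = unit_direction (f v)" if "v \<noteq> 0" for v
    using f that by (simp add: unit_direction_def sgn_div_norm orthogonal_transformation_norm
      orthogonal_transformation_scaleR) (metis norm_eq_zero orthogonal_transformation_norm)
  have "(\<integral>w. F (f w) \<partial>sphere_measure) = (\<integral>v. F (f (unit_direction v)) \<partial>unit_ball_measure)"
    unfolding sphere_measure_def by (intro integral_distr) measurable
  also have "\<dots> = (\<integral>v. F (unit_direction (f v)) \<partial>unit_ball_measure)"
  proof (rule integral_cong_AE)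
    show "(\<lambda>v. F (f (unit_direction v))) \<in> borel_measurable unit_ball_measure"
      using measurable_compose[OF unit_direction_measurable \<open>(\<lambda>w. F (f w)) \<in> _\<close>]
      by (simp cong: measurable_cong_sets)
    show "AE v in unit_ball_measure. F (f (unit_direction v)) = F (unit_direction (f v))"
      using AE_unit_ball_measure_nonzero by eventually_elim (simp add: comm)
  qed measurable
  also have "\<dots> = (\<integral>v. F (unit_direction v) \<partial>distr unit_ball_measure borel f)"
    by (rule integral_distr[symmetric]) measurable
  also have "\<dots> = (\<integral>w. F w \<partial>sphere_measure)"
    unfolding unit_ball_measure_orthogonal[OF f] sphere_measure_def
    by (rule integral_distr[symmetric]) measurable
  finally show ?thesis .
qed

text \<open>The open cone over \<open>U\<close> inside the punctured ball contains a small ball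
  around \<open>(1/2) *\<^sub>R e\<close>, which has positive volume.\<close>

lemma sphere_measure_open_pos:
  fixes e :: "'a::euclidean_space"
  assumes U: "open U" and e: "e \<in> U" "norm e = 1"
  shows "measure sphere_measure (U \<inter> sphere 0 1) > 0"
proof -
  interpret B: prob_space "unit_ball_measure :: 'a measure" by (rule prob_space_unit_ball_measure)
  have Us: "U \<inter> sphere 0 1 \<in> sets (restrict_space borel (sphere 0 1))"
    using sets_sphere_measure_open[OF U] by simp
  define V where "V = sgn -` U \<inter> (ball 0 1 - {0})"
  have "continuous_on (ball 0 1 - {0}) (\<lambda>v::'a. v /\<^sub>R norm v)"
    by (intro continuous_intros) auto
  then have "continuous_on (ball 0 1 - {0}) (sgn :: 'a \<Rightarrow> 'a)"
    unfolding sgn_div_norm[abs_def] .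
  then have V: "open V"
    unfolding V_def using U by (subst (asm) continuous_on_open_vimage) (auto simp: open_delete)
  have "(1/2) *\<^sub>R e \<in> V"
    using e by (auto simp: V_def sgn_scaleR sgn_div_norm)
  then obtain r where r: "r > 0" "ball ((1/2) *\<^sub>R e) r \<subseteq> V"
    using V by (meson openE)
  have "emeasure lborel (ball ((1/2) *\<^sub>R e) r) \<le> emeasure lborel V"
    using V r(2) by (intro emeasure_mono) auto
  then have "emeasure lborel V \<noteq> 0"
    using r(1) by (simp add: emeasure_ball) (metis antisym zero_le ennreal_eq_0_iff not_less unit_ball_vol_pos of_nat_0_le_iff zero_less_power mult_pos_pos)
  moreover have "ball 0 1 \<inter> V = V" by (auto simp: V_def)
  ultimately have "emeasure unit_ball_measure V \<noteq> 0"
    using V by (simp add: unit_ball_measure_def ennreal_divide_eq_0_iff emeasure_ball)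
  then have "0 < measure unit_ball_measure V"
    by (simp add: B.emeasure_eq_measure zero_less_measure_iff)
  also have "\<dots> \<le> measure unit_ball_measure (unit_direction -` (U \<inter> sphere 0 1))"
  proof (rule B.finite_measure_mono)
    show "V \<subseteq> unit_direction -` (U \<inter> sphere 0 1)"
      by (auto simp: V_def unit_direction_def norm_sgn)
    show "unit_direction -` (U \<inter> sphere 0 1) \<in> B.events"
      using measurable_sets[OF unit_direction_measurable Us] by simp
  qed
  also have "\<dots> = measure sphere_measure (U \<inter> sphere 0 1)"
    unfolding sphere_measure_def using Us by (subst measure_distr) (auto cong: measurable_cong_sets)
  finally show ?thesis .
qed

section \<open>Reflections and two-point homogeneity\<close>

lemma reflection_exists:
  fixes x y :: "'a::real_inner"
  assumes "norm x = norm y"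
  shows "\<exists>f. orthogonal_transformation f \<and> f x = y \<and> (\<forall>z. z \<bullet> x = z \<bullet> y \<longrightarrow> f z = z)"
proof (cases "x = y")
  case True
  then show ?thesis
    by (intro exI[of _ "\<lambda>z. z"]) simp
next
  case False
  \<comment> \<open>The reflection in the hyperplane orthogonal to \<open>x - y\<close>; a
    \<open>z\<close> with equal inner products with \<open>x\<close> and \<open>y\<close> lies in
    that hyperplane.\<close>
  define a where "a = x - y"
  have a: "a \<bullet> a \<noteq> 0" using False by (simp add: a_def)
  define f where "f z = z - (2 * (a \<bullet> z) / (a \<bullet> a)) *\<^sub>R a" for z
  have "linear f"
    unfolding f_def[abs_def]
    by (auto intro!: linearI simp: algebra_simps inner_simps add_divide_distrib)
  moreover have "f v \<bullet> f w = v \<bullet> w" for v w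
    using a by (simp add: f_def inner_simps inner_commute[of v a] inner_commute[of w a] field_simps)
  moreover have "f x = y"
  proof -
    have "x \<bullet> x = y \<bullet> y"
      using assms by (simp add: norm_eq)
    then have "2 * (a \<bullet> x) = a \<bullet> a"
      by (simp add: a_def inner_simps inner_commute)
    then show ?thesis
      using a by (simp add: f_def a_def)
  qed
  moreover have "f z = z" if "z \<bullet> x = z \<bullet> y" for z
    using that by (simp add: f_def a_def inner_simps inner_commute)
  ultimately show ?thesis
    unfolding orthogonal_transformation_def by blast
qed

text \<open>After a first reflection takes \<open>x\<close> to \<open>x'\<close>, a second one takes
  the image of \<open>y\<close> to \<open>y'\<close>. The second one fixes \<open>x'\<close>, since
  the inner products of \<open>x'\<close> with these two points agree.\<close>

lemma two_point_homogeneous: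
  fixes x y x' y' :: "'a::real_inner"
  assumes "norm x = norm x'" "norm y = norm y'" "x \<bullet> y = x' \<bullet> y'"
  shows "\<exists>f. orthogonal_transformation f \<and> f x = x' \<and> f y = y'"
proof -
  obtain f where f: "orthogonal_transformation f" "f x = x'"
    using reflection_exists[OF assms(1)] by blast
  have "norm (f y) = norm y'"
    using f(1) assms(2) by (simp add: orthogonal_transformation_norm)
  then obtain g where g: "orthogonal_transformation g" "g (f y) = y'"
      "\<And>z. z \<bullet> f y = z \<bullet> y' \<Longrightarrow> g z = z"
    using reflection_exists by blast
  have "x' \<bullet> f y = x' \<bullet> y'"
    using f assms(3) by (metis orthogonal_transformation_def)
  then have "g x' = x'" by (rule g(3))
  then show ?thesis
    using orthogonal_transformation_compose[OF g(1) f(1)] f(2) g(2)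
    by (intro exI[of _ "g \<circ> f"]) simp
qed

lemma inner_sphere_range:
  fixes x w :: "'a::real_inner"
  shows "norm x = 1 \<Longrightarrow> norm w = 1 \<Longrightarrow> x \<bullet> w \<in> {-1..1}"
  using Cauchy_Schwarz_ineq2[of x w] by auto

lemma continuous_on_zonal:
  fixes x :: "'a::real_inner"
  assumes "continuous_on {-1..1} \<phi>" "norm x = 1"
  shows "continuous_on (sphere 0 1) (\<lambda>w. \<phi> (x \<bullet> w))"
  by (rule continuous_on_compose2[OF assms(1)])
    (use assms(2) in \<open>auto intro!: continuous_intros dest: inner_sphere_range[of x]\<close>)

lemma Fubini_sphere:
  fixes F :: "'a::euclidean_space \<Rightarrow> 'a \<Rightarrow> real"
  assumes "continuous_on (sphere 0 1 \<times> sphere 0 1) (\<lambda>(x, y). F x y)"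
  shows "(\<integral>x. \<integral>y. F x y \<partial>sphere_measure \<partial>sphere_measure) =
         (\<integral>y. \<integral>x. F x y \<partial>sphere_measure \<partial>sphere_measure)"
proof -
  interpret S: prob_space "sphere_measure :: 'a measure"
    by (rule prob_space_sphere_measure)
  interpret P: pair_prob_space "sphere_measure :: 'a measure" "sphere_measure :: 'a measure" ..
  have "bounded ((\<lambda>(x, y). F x y) ` (sphere 0 1 \<times> sphere 0 1))"
    using assms by (intro compact_imp_bounded compact_continuous_image compact_Times) auto
  then obtain b where b: "\<forall>z\<in>sphere 0 1 \<times> sphere 0 1. norm (case z of (x, y) \<Rightarrow> F x y) \<le> b"
    by (auto simp: bounded_iff)
  \<comment> \<open>Joint measurability: the identity is viewed as a map into the Borel sets of the
    product of spheres, where continuity of the integrand can be used.\<close>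
  have "(\<lambda>z. (fst z, snd z)) \<in> measurable (sphere_measure \<Otimes>\<^sub>M sphere_measure) ((borel :: 'a measure) \<Otimes>\<^sub>M (borel :: 'a measure))"
    using measurable_compose[OF measurable_fst[of "sphere_measure :: 'a measure" "sphere_measure :: 'a measure"] borel_measurable_sphere_measure_id]
      measurable_compose[OF measurable_snd[of "sphere_measure :: 'a measure" "sphere_measure :: 'a measure"] borel_measurable_sphere_measure_id]
    by (intro measurable_Pair) simp_all
  then have "(\<lambda>z. z) \<in> measurable (sphere_measure \<Otimes>\<^sub>M sphere_measure)
      (restrict_space borel (sphere (0::'a) 1 \<times> sphere (0::'a) 1))"
    unfolding borel_prod by (intro measurable_restrict_space2) (auto simp: space_pair_measure)
  from measurable_compose[OF this borel_measurable_continuous_on_restrict[OF assms]]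
  have "(\<lambda>(x, y). F x y) \<in> borel_measurable (sphere_measure \<Otimes>\<^sub>M sphere_measure)" .
  then have "integrable (sphere_measure \<Otimes>\<^sub>M sphere_measure) (\<lambda>(x, y). F x y)"
    using b by (intro P.integrable_const_bound[of _ b]) (auto simp: space_pair_measure)
  then show ?thesis
    by (rule P.Fubini_integral[symmetric])
qed

section \<open>Means of functions of latitude\<close>

locale round_sphere =
  fixes e :: "'a::euclidean_space" and d :: nat
  assumes norm_e: "norm e = 1" and DIM_eq: "DIM('a) = Suc d" and d: "d \<ge> 1"
begin

sublocale prob_space "sphere_measure :: 'a measure"
  by (rule prob_space_sphere_measure)

text \<open>Integration over \<open>[-1,1]\<close> against the normalized weight
  \<open>(1 - t^2)^((d-2)/2)\<close>, without the weight ever being written down; \<open>e\<close>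
  is an arbitrary pole.\<close>

definition zmean :: "(real \<Rightarrow> real) \<Rightarrow> real" where
  "zmean \<phi> = (\<integral>w. \<phi> (e \<bullet> w) \<partial>sphere_measure)"

text \<open>A reflection that takes \<open>x\<close> to the pole \<open>e\<close> preserves the
  measure, so the choice of the pole is immaterial.\<close>

lemma integral_zonal:
  assumes "continuous_on {-1..1} \<phi>" "norm (x::'a) = 1"
  shows "(\<integral>w. \<phi> (x \<bullet> w) \<partial>sphere_measure) = zmean \<phi>"
proof -
  obtain f where f: "orthogonal_transformation f" "f x = e"
    using reflection_exists[of x e] assms(2) norm_e by auto
  have "(\<integral>w. \<phi> (e \<bullet> w) \<partial>sphere_measure) = (\<integral>w. \<phi> (e \<bullet> f w) \<partial>sphere_measure)"
    by (rule integral_sphere_orthogonal[OF f(1) continuous_on_zonal[OF assms(1) norm_e], symmetric])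
  also have "\<dots> = (\<integral>w. \<phi> (x \<bullet> w) \<partial>sphere_measure)"
    using f by (metis orthogonal_transformation_def)
  finally show ?thesis by (simp add: zmean_def)
qed

lemma integrable_zonal [simp]:
  "continuous_on {-1..1} (\<phi> :: real \<Rightarrow> real) \<Longrightarrow> integrable sphere_measure (\<lambda>w. \<phi> (e \<bullet> w))"
  by (rule integrable_sphere_measure[OF continuous_on_zonal[OF _ norm_e]])

lemma zmean_cong: "(\<And>t. t \<in> {-1..1} \<Longrightarrow> \<phi> t = \<psi> t) \<Longrightarrow> zmean \<phi> = zmean \<psi>"
  unfolding zmean_def by (intro Bochner_Integration.integral_cong refl) (metis inner_sphere_range[OF norm_e] mem_sphere_0 space_sphere_measure)

lemma zmean_mono:
  assumes "continuous_on {-1..1} \<phi>" "continuous_on {-1..1} \<psi>" "\<And>t. t \<in> {-1..1} \<Longrightarrow> \<phi> t \<le> \<psi> t"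
  shows "zmean \<phi> \<le> zmean \<psi>"
  unfolding zmean_def using norm_e assms
  by (intro integral_mono) (auto intro!: assms(3) dest: inner_sphere_range[OF norm_e])

lemma zmean_const [simp]: "zmean (\<lambda>_. c) = c"
  using prob_space by (simp add: zmean_def)

lemma zmean_add:
  "continuous_on {-1..1} \<phi> \<Longrightarrow> continuous_on {-1..1} \<psi> \<Longrightarrow>
    zmean (\<lambda>t. \<phi> t + \<psi> t) = zmean \<phi> + zmean \<psi>"
  unfolding zmean_def by (intro Bochner_Integration.integral_add integrable_zonal)

lemma zmean_diff:
  "continuous_on {-1..1} \<phi> \<Longrightarrow> continuous_on {-1..1} \<psi> \<Longrightarrow>
    zmean (\<lambda>t. \<phi> t - \<psi> t) = zmean \<phi> - zmean \<psi>"
  unfolding zmean_def by (intro Bochner_Integration.integral_diff integrable_zonal)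

lemma zmean_cmult: "zmean (\<lambda>t. c * \<phi> t) = c * zmean \<phi>"
  by (simp add: zmean_def)

lemma zmean_sum:
  "(\<And>i. i \<in> A \<Longrightarrow> continuous_on {-1..1} (\<phi> i)) \<Longrightarrow>
    zmean (\<lambda>t. \<Sum>i\<in>A. \<phi> i t) = (\<Sum>i\<in>A. zmean (\<phi> i))"
  unfolding zmean_def by (intro Bochner_Integration.integral_sum integrable_zonal)

lemma orthonormal_exists: "norm x = 1 \<Longrightarrow> \<exists>v::'a. norm v = 1 \<and> x \<bullet> v = 0"
proof -
  obtain y :: 'a where "y \<noteq> 0" "orthogonal x y"
    using orthogonal_to_vector_exists[of x] DIM_eq d by auto
  then show ?thesis
    by (intro exI[of _ "sgn y"]) (auto simp: norm_sgn sgn_div_norm orthogonal_def)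
qed

lemma latitude_exists:
  assumes "norm x = 1" "norm v = 1" "x \<bullet> v = 0" "t \<in> {-1..1}"
  shows "norm (t *\<^sub>R x + sqrt (1 - t\<^sup>2) *\<^sub>R v) = 1" "x \<bullet> (t *\<^sub>R x + sqrt (1 - t\<^sup>2) *\<^sub>R v) = t"
proof -
  have "t\<^sup>2 \<le> 1" using assms(4) by (auto simp: abs_square_le_1)
  moreover have "x \<bullet> x = 1" "v \<bullet> v = 1" "v \<bullet> x = 0"
    using assms by (simp_all add: dot_square_norm inner_commute)
  ultimately show "norm (t *\<^sub>R x + sqrt (1 - t\<^sup>2) *\<^sub>R v) = 1" "x \<bullet> (t *\<^sub>R x + sqrt (1 - t\<^sup>2) *\<^sub>R v) = t"
    using assms(3) by (simp_all add: norm_eq_1 inner_simps power2_eq_square[symmetric])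
qed

text \<open>Continuity keeps the integrand above \<open>\<phi> t / 2\<close> on a neighbourhood of a
  point of latitude \<open>t\<close>, and this neighbourhood has positive measure.\<close>

lemma zmean_pos:
  assumes \<phi>: "continuous_on {-1..1} \<phi>" "\<And>t. t \<in> {-1..1} \<Longrightarrow> \<phi> t \<ge> 0"
    and t: "t \<in> {-1..1}" "\<phi> t > 0"
  shows "zmean \<phi> > 0"
proof -
  obtain v where v: "norm v = 1" "e \<bullet> v = 0"
    using orthonormal_exists[OF norm_e] by blast
  define x where "x = t *\<^sub>R e + sqrt (1 - t\<^sup>2) *\<^sub>R v"
  have x: "norm x = 1" "e \<bullet> x = t"
    using latitude_exists[OF norm_e v t(1)] by (simp_all add: x_def)
  have "continuous_on (sphere 0 1) (\<lambda>w. \<phi> (e \<bullet> w))"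
    using \<phi>(1) norm_e by (rule continuous_on_zonal)
  then obtain U where U: "open U" "U \<inter> sphere 0 1 = (\<lambda>w. \<phi> (e \<bullet> w)) -` {\<phi> t / 2 <..} \<inter> sphere 0 1"
    using continuous_on_open_invariant by (metis open_greaterThan)
  have xU: "x \<in> U"
  proof -
    have "x \<in> (\<lambda>w. \<phi> (e \<bullet> w)) -` {\<phi> t / 2 <..} \<inter> sphere 0 1"
      using x t(2) by simp
    then show ?thesis unfolding U(2)[symmetric] by simp
  qed
  have m: "measure sphere_measure (U \<inter> sphere 0 1) > 0"
    using sphere_measure_open_pos[OF U(1) xU x(1)] .
  have Us: "U \<inter> sphere 0 1 \<in> sets sphere_measure"
    using U(1) by (rule sets_sphere_measure_open)
  have "0 < \<phi> t / 2 * measure sphere_measure (U \<inter> sphere 0 1)"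
    using m t(2) by simp
  also have "\<dots> = (\<integral>w. \<phi> t / 2 * indicator (U \<inter> sphere 0 1) w \<partial>sphere_measure)"
    using Us by simp
  also have "\<dots> \<le> zmean \<phi>"
    unfolding zmean_def
  proof (rule integral_mono)
    fix w :: 'a assume "w \<in> space sphere_measure"
    then have w: "norm w = 1" by simp
    have "\<phi> (e \<bullet> w) \<ge> 0"
      using \<phi>(2)[OF inner_sphere_range[OF norm_e w]] .
    moreover have "\<phi> (e \<bullet> w) > \<phi> t / 2" if "w \<in> U"
    proof -
      have "w \<in> U \<inter> sphere 0 1" using that w by simp
      then show ?thesis unfolding U(2) by simp
    qed
    ultimately show "\<phi> t / 2 * indicator (U \<inter> sphere 0 1) w \<le> \<phi> (e \<bullet> w)"
      by (auto simp: indicator_def)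
  qed (use Us \<phi>(1) in \<open>auto simp: less_top[symmetric]\<close>)
  finally show ?thesis .
qed

text \<open>Two-point homogeneity: the integral sees the two points only through their inner
  product, so they can be moved to convenient positions.\<close>

lemma integral_pair_cong:
  fixes F :: "real \<Rightarrow> real \<Rightarrow> real" and x y x' y' :: 'a
  assumes "norm x = 1" "norm y = 1" "norm x' = 1" "norm y' = 1" "x \<bullet> y = x' \<bullet> y'"
    and F: "continuous_on ({-1..1} \<times> {-1..1}) (\<lambda>(s, t). F s t)"
  shows "(\<integral>w. F (x \<bullet> w) (y \<bullet> w) \<partial>sphere_measure) = (\<integral>w. F (x' \<bullet> w) (y' \<bullet> w) \<partial>sphere_measure)"
proof -
  obtain f where f: "orthogonal_transformation f" "f x = x'" "f y = y'"
    using two_point_homogeneous[of x x' y y'] assms by auto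
  have "continuous_on (sphere 0 1) (\<lambda>w. case (x' \<bullet> w, y' \<bullet> w) of (s, t) \<Rightarrow> F s t)"
    using assms by (intro continuous_on_compose2[OF F])
      (auto intro!: continuous_intros dest: inner_sphere_range[of x'] inner_sphere_range[of y'])
  then have "(\<integral>w. F (x' \<bullet> f w) (y' \<bullet> f w) \<partial>sphere_measure) = (\<integral>w. F (x' \<bullet> w) (y' \<bullet> w) \<partial>sphere_measure)"
    using integral_sphere_orthogonal[OF f(1), of "\<lambda>w. F (x' \<bullet> w) (y' \<bullet> w)"] by simp
  moreover have "x' \<bullet> f w = x \<bullet> w" "y' \<bullet> f w = y \<bullet> w" for w
    using f by (metis orthogonal_transformation_def)+
  ultimately show ?thesis by simp
qed

end

section \<open>Zonal polynomials\<close>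

context round_sphere
begin

text \<open>Replacing \<open>v\<close> by \<open>- v\<close> keeps the pair orthonormal but changes
  the sign of the integral.\<close>

lemma integral_sphere_parity:
  fixes u v :: 'a
  assumes uv: "norm u = 1" "norm v = 1" "u \<bullet> v = 0" and \<phi>: "continuous_on {-1..1} \<phi>"
    and "odd j"
  shows "(\<integral>w. \<phi> (u \<bullet> w) * (v \<bullet> w) ^ j \<partial>sphere_measure) = 0"
proof -
  have "continuous_on ({-1..1} \<times> {-1..1}) (\<lambda>z. \<phi> (fst z) * snd z ^ j)"
    by (intro continuous_intros continuous_on_compose2[OF \<phi>]) auto
  then have "(\<integral>w. \<phi> (u \<bullet> w) * (v \<bullet> w) ^ j \<partial>sphere_measure) =
        (\<integral>w. \<phi> (u \<bullet> w) * (- v \<bullet> w) ^ j \<partial>sphere_measure)"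
    using uv by (intro integral_pair_cong[where F = "\<lambda>s t. \<phi> s * t ^ j"]) (auto simp: split_beta)
  also have "\<dots> = - (\<integral>w. \<phi> (u \<bullet> w) * (v \<bullet> w) ^ j \<partial>sphere_measure)"
    using \<open>odd j\<close> by (simp add: power_minus_odd)
  finally show ?thesis by simp
qed

text \<open>Rotating the orthonormal pair by the angle \<open>arctan \<tau>\<close> does not change the (vanishing)
  integral of \<open>(u \<bullet> w)\<^sup>k (v \<bullet> w)\<close>; the claim is the coefficient of \<open>\<tau>\<close> in this identity.\<close>

lemma integral_sphere_rotation:
  fixes u v :: 'a
  assumes uv: "norm u = 1" "norm v = 1" "u \<bullet> v = 0"
  shows "(\<integral>w. (u \<bullet> w) ^ Suc k \<partial>sphere_measure) =
     real k * (\<integral>w. (u \<bullet> w) ^ (k - 1) * (v \<bullet> w)\<^sup>2 \<partial>sphere_measure)"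
proof -
  define I where "I i j = (\<integral>w. (u \<bullet> w) ^ i * (v \<bullet> w) ^ j \<partial>sphere_measure)" for i j
  have int: "integrable sphere_measure (\<lambda>w. (u \<bullet> w) ^ i * (v \<bullet> w) ^ j)" for i j
    using uv by (intro integrable_sphere_measure continuous_intros)
  \<comment> \<open>The integral for the rotated pair, up to a normalizing factor, as a polynomial
    in \<open>\<tau>\<close>: the binomial expansion of the power is multiplied by the two terms of
    the second vector.\<close>
  define q where "q = (\<Sum>j\<le>k. monom (real (k choose j) * I (k - j) (Suc j)) j
      - monom (real (k choose j) * I (Suc (k - j)) j) (Suc j))"
  have "poly q \<tau> = 0" for \<tau>
  proof -
    define s where "s = sqrt (1 + \<tau>\<^sup>2)"
    have s: "s > 0" "s\<^sup>2 = 1 + \<tau>\<^sup>2" by (auto simp: s_def add_pos_nonneg)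
    define u' v' where "u' = (1/s) *\<^sub>R (u + \<tau> *\<^sub>R v)" and "v' = (1/s) *\<^sub>R (v - \<tau> *\<^sub>R u)"
    have uu: "u \<bullet> u = 1" "v \<bullet> v = 1" "v \<bullet> u = 0"
      using uv by (simp_all add: dot_square_norm inner_commute)
    have ss: "1 + \<tau> * \<tau> = s * s" using s by (simp add: power2_eq_square)
    have "u' \<bullet> u' = 1" "v' \<bullet> v' = 1" "u' \<bullet> v' = 0"
      using s(1) uv(3) uu by (simp_all add: u'_def v'_def inner_simps ss field_simps)
    then have "0 = (\<integral>w. (u' \<bullet> w) ^ k * (v' \<bullet> w) ^ 1 \<partial>sphere_measure)"
      by (intro integral_sphere_parity[symmetric] continuous_intros) (simp_all add: norm_eq_1)
    also have "\<dots> = (1/s) ^ Suc k * (\<integral>w. (u \<bullet> w + \<tau> * (v \<bullet> w)) ^ k * (v \<bullet> w - \<tau> * (u \<bullet> w)) \<partial>sphere_measure)"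
      by (simp add: u'_def v'_def inner_simps power_mult_distrib power_divide mult_ac
         flip: integral_mult_right_zero)
    finally have "0 = (\<integral>w. (u \<bullet> w + \<tau> * (v \<bullet> w)) ^ k * (v \<bullet> w - \<tau> * (u \<bullet> w)) \<partial>sphere_measure)"
      using s(1) by simp
    also have "(\<lambda>w. (u \<bullet> w + \<tau> * (v \<bullet> w)) ^ k * (v \<bullet> w - \<tau> * (u \<bullet> w))) =
       (\<lambda>w. \<Sum>j\<le>k. real (k choose j) * \<tau> ^ j * ((u \<bullet> w) ^ (k - j) * (v \<bullet> w) ^ Suc j)
             - real (k choose j) * \<tau> ^ Suc j * ((u \<bullet> w) ^ Suc (k - j) * (v \<bullet> w) ^ j))"
      by (rule ext) (subst add.commute, subst binomial_ring,
         simp add: sum_distrib_right sum_distrib_left sum_subtractf power_mult_distrib algebra_simps)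
    also have "integral\<^sup>L sphere_measure \<dots> = (\<Sum>j\<le>k. real (k choose j) * \<tau> ^ j * I (k - j) (Suc j)
         - real (k choose j) * \<tau> ^ Suc j * I (Suc (k - j)) j)"
      using int by (simp add: I_def del: power_Suc)
    also have "\<dots> = poly q \<tau>"
      by (simp add: q_def poly_sum poly_monom mult_ac del: power_Suc)
    finally show ?thesis by simp
  qed
  then have "q = 0"
    by (intro poly_all_0_iff_0[THEN iffD1] allI)
  \<comment> \<open>To the coefficient of \<open>\<tau>\<close> only \<open>j = 1\<close>
    contributes in the first family and only \<open>j = 0\<close> in the second. For
    \<open>k = 0\<close> the factor \<open>real k\<close> absorbs the truncated subtraction
    \<open>k - 1\<close>.\<close>
  then have "0 = coeff q 1" by simp
  also have "\<dots> = (\<Sum>j\<le>k. (if j = 1 then real (k choose j) * I (k - j) (Suc j) else 0)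
      - (if j = 0 then real (k choose j) * I (Suc (k - j)) j else 0))"
    unfolding q_def coeff_sum by (intro sum.cong) auto
  also have "\<dots> = real k * I (k - 1) 2 - I (Suc k) 0"
    by (simp add: sum_subtractf numeral_2_eq_2)
  finally show ?thesis
    by (simp add: I_def)
qed

section \<open>Orthogonality of the zonal polynomials\<close>

abbreviation pmean :: "real poly \<Rightarrow> real" where
  "pmean p \<equiv> zmean (poly p)"

lemma continuous_on_poly_fun [simp]: "continuous_on A (poly (p :: real poly))"
  by (intro continuous_intros)

lemma pmean_add: "pmean (p + q) = pmean p + pmean q"
  using zmean_add[of "poly p" "poly q"] by (simp add: poly_add[abs_def])

lemma pmean_diff: "pmean (p - q) = pmean p - pmean q"
  using zmean_diff[of "poly p" "poly q"] by (simp add: poly_diff[abs_def])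

lemma pmean_smult: "pmean (smult c p) = c * pmean p"
  using zmean_cmult[of c "poly p"] by (simp add: poly_smult[abs_def])

lemma pmean_sum: "pmean (\<Sum>i\<in>A. f i) = (\<Sum>i\<in>A. pmean (f i))"
  using zmean_sum[of A "\<lambda>i. poly (f i)"] by (simp add: poly_sum[abs_def])

lemma pmean_of_nat: "pmean (of_nat n * p) = real n * pmean p"
  using pmean_smult[of "real n" p] by (simp add: smult_real)

text \<open>The rotation identity is summed over the \<open>d\<close> basis vectors orthogonal to a
  basis vector \<open>u\<close>; on the sphere their squared coordinates add up to
  \<open>1 - (u \<bullet> w)\<^sup>2\<close>.\<close>

lemma pmean_moment: "real d * zmean (\<lambda>t. t ^ Suc k) = real k * zmean (\<lambda>t. t ^ (k - 1) * (1 - t\<^sup>2))"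
proof -
  obtain u :: 'a where u: "u \<in> Basis"
    using nonempty_Basis by blast
  then have nu: "norm u = 1" by simp
  have int: "integrable sphere_measure (\<lambda>w. (u \<bullet> w) ^ i * (b \<bullet> w)\<^sup>2)" for i b
    using nu by (intro integrable_sphere_measure continuous_intros)
  have "real d * zmean (\<lambda>t. t ^ Suc k) = (\<Sum>b\<in>Basis - {u}. zmean (\<lambda>t. t ^ Suc k))"
    using u DIM_eq by simp
  also have "\<dots> = (\<Sum>b\<in>Basis - {u}. real k * (\<integral>w. (u \<bullet> w) ^ (k - 1) * (b \<bullet> w)\<^sup>2 \<partial>sphere_measure))"
  proof (intro sum.cong refl)
    fix b assume b: "b \<in> Basis - {u}"
    have "zmean (\<lambda>t. t ^ Suc k) = (\<integral>w. (u \<bullet> w) ^ Suc k \<partial>sphere_measure)"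
      using nu by (intro integral_zonal[symmetric] continuous_intros)
    then show "zmean (\<lambda>t. t ^ Suc k) = real k * (\<integral>w. (u \<bullet> w) ^ (k - 1) * (b \<bullet> w)\<^sup>2 \<partial>sphere_measure)"
      using integral_sphere_rotation[of u b k] inner_not_same_Basis[of u b] u b by auto
  qed
  also have "\<dots> = real k * (\<integral>w. (\<Sum>b\<in>Basis - {u}. (u \<bullet> w) ^ (k - 1) * (b \<bullet> w)\<^sup>2) \<partial>sphere_measure)"
    using int by (simp add: sum_distrib_left)
  also have "(\<integral>w. (\<Sum>b\<in>Basis - {u}. (u \<bullet> w) ^ (k - 1) * (b \<bullet> w)\<^sup>2) \<partial>sphere_measure) =
      (\<integral>w. (u \<bullet> w) ^ (k - 1) * (1 - (u \<bullet> w)\<^sup>2) \<partial>sphere_measure)"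
  proof (rule Bochner_Integration.integral_cong[OF refl])
    fix w :: 'a assume "w \<in> space sphere_measure"
    then have "1 = (\<Sum>b\<in>Basis. (b \<bullet> w)\<^sup>2)"
      by (simp add: norm_eq_1 euclidean_inner[of w w] power2_eq_square inner_commute)
    also have "\<dots> = (\<Sum>b\<in>Basis - {u}. (b \<bullet> w)\<^sup>2) + (u \<bullet> w)\<^sup>2"
      using u by (simp add: sum.remove add.commute)
    finally show "(\<Sum>b\<in>Basis - {u}. (u \<bullet> w) ^ (k - 1) * (b \<bullet> w)\<^sup>2) = (u \<bullet> w) ^ (k - 1) * (1 - (u \<bullet> w)\<^sup>2)"
      by (simp add: sum_distrib_left[symmetric])
  qed
  also have "\<dots> = zmean (\<lambda>t. t ^ (k - 1) * (1 - t\<^sup>2))"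
    using nu by (intro integral_zonal continuous_intros)
  finally show ?thesis .
qed

text \<open>Integration by parts against the implicit weight, obtained from
  \<open>pmean_moment\<close> on monomials and extended by linearity.\<close>

lemma pmean_pderiv: "pmean ((1 - [:0, 1:]\<^sup>2) * pderiv p) = real d * pmean ([:0, 1:] * p)"
proof -
  have mono: "pmean ((1 - [:0, 1:]\<^sup>2) * pderiv (monom c k)) = real d * pmean ([:0, 1:] * monom c k)" for c k
  proof -
    have "pmean ((1 - [:0, 1:]\<^sup>2) * pderiv (monom c k)) =
        zmean (\<lambda>t. c * (real k * (t ^ (k - 1) * (1 - t\<^sup>2))))"
      by (intro zmean_cong) (simp add: pderiv_monom poly_monom)
    moreover have "pmean ([:0, 1:] * monom c k) = zmean (\<lambda>t. c * t ^ Suc k)"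
      by (intro zmean_cong) (simp add: poly_monom)
    ultimately show ?thesis
      using pmean_moment[of k] by (simp add: zmean_cmult)
  qed
  have "pmean ((1 - [:0, 1:]\<^sup>2) * pderiv (\<Sum>i\<le>degree p. monom (coeff p i) i)) =
     real d * pmean ([:0, 1:] * (\<Sum>i\<le>degree p. monom (coeff p i) i))"
    by (simp add: higher_pderiv_sum[where n = 1, simplified] sum_distrib_left pmean_sum mono del: mult_pCons_left)
  then show ?thesis
    by (simp only: poly_as_sum_of_monoms)
qed

text \<open>The mean of \<open>[:0, 1:] * zonal d (Suc l)\<close> is eliminated between the first
  ladder relation, integrated by \<open>pmean_pderiv\<close>, and the three-term recurrence.\<close>

lemma pmean_zonal_step:
  "(real l + 1 + real d) * (real l + real d) * pmean (zonal d (Suc (Suc l))) =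
     (real l + 1) * real l * pmean (zonal d l)"
proof -
  define A B C where "A = pmean (zonal d l)" and "B = pmean ([:0, 1:] * zonal d (Suc l))"
    and "C = pmean (zonal d (Suc (Suc l)))"
  have "real (l + 1) * (A - B) = real d * B"
    using pmean_pderiv[of "zonal d (Suc l)"]
    by (simp only: conjunct1[OF zonal_deriv[OF d]] pmean_of_nat pmean_diff A_def B_def)
  then have "(real l + 1) * (A - B) = real d * B" by (simp only: of_nat_add of_nat_1)
  moreover have "real (l + d) * C = real (2 * l + d + 1) * B - real (l + 1) * A"
    using arg_cong[OF zonal_rec[OF d, of l], of pmean]
    by (simp only: pmean_of_nat pmean_diff A_def B_def C_def)
  then have "(real l + real d) * C = (2 * real l + real d + 1) * B - (real l + 1) * A"
    by (simp only: of_nat_add of_nat_1 of_nat_mult of_nat_numeral)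
  ultimately have "(real l + 1 + real d) * (real l + real d) * C = (real l + 1) * real l * A"
    by algebra
  then show ?thesis by (simp add: A_def C_def)
qed

text \<open>Orthogonality to constants. The recursion goes in steps of two: degree 1 comes from
  \<open>pmean_pderiv\<close> with \<open>p = 1\<close>, degree 2 from the factor
  \<open>real l\<close> in \<open>pmean_zonal_step\<close>, which vanishes for
  \<open>l = 0\<close>.\<close>

lemma pmean_zonal: "pmean (zonal d (Suc l)) = 0"
proof (induction l rule: induct_nat_012)
  case 0
  show ?case
    using pmean_pderiv[of 1] d by (simp add: zmean_def)
next
  case 1
  then show ?case
    using pmean_zonal_step[of 0] d by (simp del: zonal.simps)
next
  case (ge2 l)
  have "real (Suc l) + 1 + real d \<noteq> 0" "real (Suc l) + real d \<noteq> 0" by linarith+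
  then show ?case
    using pmean_zonal_step[of "Suc l"] ge2 by (simp del: zonal.simps)
qed

text \<open>The recurrence trades one factor \<open>[:0, 1:]\<close> for a shift of the index by one
  in either direction, so the exponent stays below the index.\<close>

lemma pmean_monom_zonal: "j < l \<Longrightarrow> pmean ([:0, 1:] ^ j * zonal d l) = 0"
proof (induction j arbitrary: l)
  case 0
  then show ?case
    using pmean_zonal[of "l - 1"] by simp
next
  case (Suc j)
  then obtain k where k: "l = Suc k" "j < k"
    by (metis Suc_less_eq2)
  define X :: "real poly" where "X = [:0, 1:]"
  have "of_nat (2 * k + d + 1) * (X ^ Suc j * zonal d l) =
      X ^ j * (of_nat (2 * k + d + 1) * (X * zonal d (Suc k)))"
    by (simp add: k(1) mult_ac)
  also have "\<dots> = of_nat (k + d) * (X ^ j * zonal d (Suc (Suc k))) + of_nat (k + 1) * (X ^ j * zonal d k)"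
  proof -
    have "of_nat (2 * k + d + 1) * (X * zonal d (Suc k)) =
        of_nat (k + d) * zonal d (Suc (Suc k)) + of_nat (k + 1) * zonal d k"
      using zonal_rec[OF d, of k] by (simp only: X_def diff_add_cancel)
    then show ?thesis by (simp only: distrib_left mult_ac)
  qed
  finally have "pmean (of_nat (2 * k + d + 1) * (X ^ Suc j * zonal d l)) =
     pmean (of_nat (k + d) * (X ^ j * zonal d (Suc (Suc k))) + of_nat (k + 1) * (X ^ j * zonal d k))"
    by (rule arg_cong)
  then have "real (2 * k + d + 1) * pmean (X ^ Suc j * zonal d l) =
     real (k + d) * pmean (X ^ j * zonal d (Suc (Suc k))) + real (k + 1) * pmean (X ^ j * zonal d k)"
    unfolding pmean_of_nat pmean_add .
  moreover have "pmean (X ^ j * zonal d (Suc (Suc k))) = 0" "pmean (X ^ j * zonal d k) = 0"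
    unfolding X_def using k(2) by (auto intro!: Suc.IH simp del: zonal.simps)
  ultimately have "real (2 * k + d + 1) * pmean (X ^ Suc j * zonal d l) = 0"
    by simp
  then show ?case
    unfolding X_def mult_eq_0_iff of_nat_eq_0_iff by (elim disjE) (simp, assumption)
qed

lemma pmean_orthogonal:
  assumes "degree q < l"
  shows "pmean (q * zonal d l) = 0"
proof -
  have "(\<Sum>i\<le>degree q. smult (coeff q i) ([:0, 1:] ^ i)) = q"
    by (simp add: poly_as_sum_of_monoms flip: monom_altdef)
  then have "pmean (q * zonal d l) = pmean ((\<Sum>i\<le>degree q. smult (coeff q i) ([:0, 1:] ^ i)) * zonal d l)"
    by simp
  also have "\<dots> = (\<Sum>i\<le>degree q. coeff q i * pmean ([:0, 1:] ^ i * zonal d l))"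
    by (simp only: sum_distrib_right pmean_sum mult_smult_left pmean_smult)
  also have "\<dots> = 0"
    using assms by (intro sum.neutral) (simp add: pmean_monom_zonal)
  finally show ?thesis .
qed

definition znorm :: "nat \<Rightarrow> real" where
  "znorm l = pmean (zonal d l * zonal d l)"

lemma pmean_zonal_zonal: "pmean (zonal d j * zonal d l) = (if j = l then znorm l else 0)"
proof -
  consider "j < l" | "j = l" | "l < j" by linarith
  then show ?thesis
  proof cases
    case 1
    then show ?thesis
      using pmean_orthogonal[of "zonal d j" l] degree_zonal_le[of d j] by simp
  next
    case 3
    then show ?thesis
      using pmean_orthogonal[of "zonal d l" j] degree_zonal_le[of d l] by (simp add: mult.commute)
  qed (simp add: znorm_def)
qed

lemma znorm_pos: "znorm l > 0"
  unfolding znorm_def by (rule zmean_pos[of _ 1]) (simp_all add: zonal_at_1[OF d] continuous_on_mult)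

text \<open>Some expansion exists by \<open>poly_in_zonal_span\<close>, and orthogonality reads off
  its coefficients.\<close>

lemma zonal_expansion:
  assumes "degree q \<le> n"
  shows "q = (\<Sum>j\<le>n. smult (pmean (q * zonal d j) / znorm j) (zonal d j))"
proof -
  obtain b where b: "q = (\<Sum>j\<le>n. smult (b j) (zonal d j))"
    using poly_in_zonal_span[OF d assms] by blast
  have "pmean (q * zonal d j) / znorm j = b j" if "j \<le> n" for j
  proof -
    have "pmean (q * zonal d j) = (\<Sum>i\<le>n. if i = j then b i * znorm j else 0)"
      unfolding arg_cong[OF b, of "\<lambda>p. pmean (p * zonal d j)"] sum_distrib_right pmean_sum mult_smult_left pmean_smult
        pmean_zonal_zonal by (intro sum.cong) auto
    then show ?thesis
      using that znorm_pos[of j] by (simp add: sum.delta)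
  qed
  then show ?thesis
    using b by simp
qed

text \<open>The integral depends only on \<open>s = x \<bullet> y\<close>, so the points may be
  taken as \<open>e\<close> and \<open>s *\<^sub>R e + c *\<^sub>R v\<close> with
  \<open>c = sqrt (1 - s\<^sup>2)\<close>. In the binomial expansion the odd powers of
  \<open>c\<close> come with integrals that vanish by parity, and the even powers are polynomials in
  \<open>s\<close>.\<close>

lemma zonal_convolution:
  assumes \<phi>: "continuous_on {-1..1} \<phi>"
  shows "\<exists>r. degree r \<le> degree q \<and> (\<forall>x y::'a. norm x = 1 \<longrightarrow> norm y = 1 \<longrightarrow>
    (\<integral>w. \<phi> (x \<bullet> w) * poly q (y \<bullet> w) \<partial>sphere_measure) = poly r (x \<bullet> y))"
proof -
  obtain v where v: "norm v = 1" "e \<bullet> v = 0"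
    using orthonormal_exists[OF norm_e] by blast
  define A where "A k j = (\<integral>w. (\<phi> (e \<bullet> w) * (e \<bullet> w) ^ (k - j)) * (v \<bullet> w) ^ j \<partial>sphere_measure)" for k j
  have A_odd: "A k j = 0" if "odd j" for k j
    unfolding A_def using norm_e v that \<phi>
    by (intro integral_sphere_parity[where \<phi> = "\<lambda>t. \<phi> t * t ^ (k - j)"]) (auto intro!: continuous_intros)
  have int: "integrable sphere_measure (\<lambda>w. (\<phi> (e \<bullet> w) * (e \<bullet> w) ^ (k - j)) * (v \<bullet> w) ^ j)" for k j
    using norm_e v by (intro integrable_sphere_measure continuous_intros continuous_on_zonal[OF \<phi>])
  \<comment> \<open>The power of \<open>[:1, 0, -1:]\<close>, that is of one minus the square of the
    variable, stands for \<open>c ^ j\<close>. This is correct for even \<open>j\<close>, and for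
    odd \<open>j\<close> the coefficient \<open>A k j\<close> is zero.\<close>
  define r where "r = (\<Sum>k\<le>degree q. smult (coeff q k) (\<Sum>j\<le>k. smult (real (k choose j) * A k j)
      ([:1, 0, -1:] ^ (j div 2) * [:0, 1:] ^ (k - j))))"
  have "degree r \<le> degree q"
    unfolding r_def
  proof (intro degree_sum_le finite_atMost order.trans[OF degree_smult_le])
    fix k j assume kj: "k \<in> {..degree q}" "j \<in> {..k}"
    have "degree ([:1, 0, -1:] ^ (j div 2) * [:0, 1:] ^ (k - j) :: real poly)
       \<le> degree ([:1, 0, -1:] ^ (j div 2) :: real poly) + degree ([:0, 1:] ^ (k - j) :: real poly)"
      by (rule degree_mult_le)
    also have "\<dots> \<le> 2 * (j div 2) + (k - j)"
      by (intro add_mono order.trans[OF degree_power_le]) auto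
    also have "\<dots> \<le> degree q" using kj by auto
    finally show "degree ([:1, 0, -1:] ^ (j div 2) * [:0, 1:] ^ (k - j) :: real poly) \<le> degree q" .
  qed
  moreover have "(\<integral>w. \<phi> (x \<bullet> w) * poly q (y \<bullet> w) \<partial>sphere_measure) = poly r (x \<bullet> y)"
    if xy: "norm x = 1" "norm y = 1" for x y :: 'a
  proof -
    define s c where "s = x \<bullet> y" and "c = sqrt (1 - s\<^sup>2)"
    have s: "s \<in> {-1..1}" using inner_sphere_range[OF xy] by (simp add: s_def)
    then have c2: "c\<^sup>2 = 1 - s\<^sup>2"
      by (simp add: c_def abs_square_le_1 abs_le_iff)
    have c_even: "c ^ j = (1 - s\<^sup>2) ^ (j div 2)" if "even j" for j
      using that by (metis c2 dvd_mult_div_cancel power_mult)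
    define z where "z = s *\<^sub>R e + c *\<^sub>R v"
    have z: "norm z = 1" "e \<bullet> z = s"
      using latitude_exists[OF norm_e v s] by (simp_all add: z_def c_def)
    have "continuous_on ({-1..1} \<times> {-1..1}) (\<lambda>z. \<phi> (fst z) * poly q (snd z))"
      by (intro continuous_intros continuous_on_compose2[OF \<phi>]) auto
    then have "(\<integral>w. \<phi> (x \<bullet> w) * poly q (y \<bullet> w) \<partial>sphere_measure) =
        (\<integral>w. \<phi> (e \<bullet> w) * poly q (z \<bullet> w) \<partial>sphere_measure)"
      using xy z norm_e
      by (intro integral_pair_cong[where F = "\<lambda>s t. \<phi> s * poly q t"]) (auto simp: split_beta s_def)
    also have "(\<lambda>w. \<phi> (e \<bullet> w) * poly q (z \<bullet> w)) = (\<lambda>w. \<Sum>k\<le>degree q. coeff q k *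
        (\<Sum>j\<le>k. (real (k choose j) * c ^ j * s ^ (k - j)) * ((\<phi> (e \<bullet> w) * (e \<bullet> w) ^ (k - j)) * (v \<bullet> w) ^ j)))"
      by (rule ext) (simp add: z_def inner_simps poly_altdef add.commute[of "s * _"] binomial_ring
          sum_distrib_left power_mult_distrib mult_ac)
    also have "integral\<^sup>L sphere_measure \<dots> = (\<Sum>k\<le>degree q. coeff q k *
        (\<Sum>j\<le>k. (real (k choose j) * c ^ j * s ^ (k - j)) * A k j))"
      using int by (simp add: A_def)
    also have "\<dots> = poly r s"
    proof -
      have "(real (k choose j) * c ^ j * s ^ (k - j)) * A k j =
          real (k choose j) * A k j * ((1 - s\<^sup>2) ^ (j div 2) * s ^ (k - j))" for k j
        using A_odd[of j k] c_even[of j] by (cases "even j") simp_all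
      moreover have "1 - s * s = 1 - s\<^sup>2" by (simp add: power2_eq_square)
      ultimately show ?thesis
        by (simp only: r_def poly_sum poly_power poly_smult poly_mult) simp
    qed
    finally show ?thesis by (simp add: s_def)
  qed
  ultimately show ?thesis by blast
qed

text \<open>The convolution of \<open>zonal d l\<close> with itself is a zonal polynomial of degree at most \<open>l\<close>,
  and by Fubini it is orthogonal to all polynomials of smaller degree.\<close>

lemma zonal_reproducing:
  fixes x y :: 'a
  assumes "norm x = 1" "norm y = 1"
  shows "(\<integral>w. poly (zonal d l) (x \<bullet> w) * poly (zonal d l) (y \<bullet> w) \<partial>sphere_measure) =
    znorm l * poly (zonal d l) (x \<bullet> y)"
proof -
  let ?R = "\<lambda>l. poly (zonal d l)"
  obtain r where "degree r \<le> degree (zonal d l)" and r: "\<And>x y::'a. norm x = 1 \<Longrightarrow> norm y = 1 \<Longrightarrow>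
      (\<integral>w. ?R l (x \<bullet> w) * ?R l (y \<bullet> w) \<partial>sphere_measure) = poly r (x \<bullet> y)"
    using zonal_convolution[of "?R l" "zonal d l"] by auto
  then have deg: "degree r \<le> l"
    using degree_zonal_le[of d l] by linarith
  \<comment> \<open>By Fubini the mean becomes that of \<open>zonal d l\<close> times its
    convolution with \<open>zonal d j\<close>, which is a polynomial of degree below
    \<open>l\<close>.\<close>
  have orth: "pmean (r * zonal d j) = 0" if "j < l" for j
  proof -
    obtain s where "degree s \<le> degree (zonal d j)" and s: "\<And>x y::'a. norm x = 1 \<Longrightarrow> norm y = 1 \<Longrightarrow>
        (\<integral>w. ?R l (x \<bullet> w) * ?R j (y \<bullet> w) \<partial>sphere_measure) = poly s (x \<bullet> y)"
      using zonal_convolution[of "?R l" "zonal d j"] by auto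
    then have deg_s: "degree s < l"
      using degree_zonal_le[of d j] that by linarith
    have "pmean (r * zonal d j) = (\<integral>y. poly r (e \<bullet> y) * ?R j (e \<bullet> y) \<partial>sphere_measure)"
      by (simp add: zmean_def)
    also have "\<dots> = (\<integral>y. \<integral>w. ?R l (e \<bullet> w) * ?R l (y \<bullet> w) * ?R j (e \<bullet> y) \<partial>sphere_measure \<partial>sphere_measure)"
      by (intro Bochner_Integration.integral_cong refl) (simp add: r[symmetric] norm_e)
    also have "\<dots> = (\<integral>w. \<integral>y. ?R l (e \<bullet> w) * ?R l (y \<bullet> w) * ?R j (e \<bullet> y) \<partial>sphere_measure \<partial>sphere_measure)"
      by (rule Fubini_sphere) (auto intro!: continuous_intros simp: split_beta)
    also have "\<dots> = (\<integral>w. ?R l (e \<bullet> w) * (\<integral>y. ?R l (w \<bullet> y) * ?R j (e \<bullet> y) \<partial>sphere_measure) \<partial>sphere_measure)"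
      by (simp add: inner_commute mult.assoc)
    also have "\<dots> = (\<integral>w. ?R l (e \<bullet> w) * poly s (e \<bullet> w) \<partial>sphere_measure)"
      by (intro Bochner_Integration.integral_cong refl) (simp add: s norm_e inner_commute[of _ e])
    also have "\<dots> = pmean (s * zonal d l)"
      by (simp add: zmean_def mult.commute)
    also have "\<dots> = 0"
      using deg_s by (rule pmean_orthogonal)
    finally show ?thesis .
  qed
  define b where "b = pmean (r * zonal d l) / znorm l"
  have "r = (\<Sum>j\<le>l. smult (pmean (r * zonal d j) / znorm j) (zonal d j))"
    using deg by (rule zonal_expansion)
  also have "\<dots> = (\<Sum>j\<in>{l}. smult (pmean (r * zonal d j) / znorm j) (zonal d j))"
    by (intro sum.mono_neutral_right) (auto simp: orth)
  finally have rb: "r = smult b (zonal d l)"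
    by (simp add: b_def)
  \<comment> \<open>Evaluation on the diagonal, where \<open>zonal d l\<close> takes the value 1,
    determines the factor.\<close>
  have "poly r (e \<bullet> e) = znorm l"
    using r[OF norm_e norm_e] by (simp add: znorm_def zmean_def)
  then have "b = znorm l"
    using norm_e d by (simp add: rb norm_eq_1 zonal_at_1)
  then show ?thesis
    using r[OF assms] by (simp add: rb)
qed

end

section \<open>Positive semidefinite kernels\<close>

text \<open>The forms are indexed by finite sets of points instead of enumerations, so that
  averaging and regrouping act directly on the weights.\<close>

definition psd_on :: "'a set \<Rightarrow> ('a \<Rightarrow> 'a \<Rightarrow> real) \<Rightarrow> bool" where
  "psd_on X K \<longleftrightarrow> (\<forall>F c. finite F \<longrightarrow> F \<subseteq> X \<longrightarrow> (\<Sum>a\<in>F. \<Sum>b\<in>F. c a * c b * K a b) \<ge> 0)"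

lemma psd_onD: "psd_on X K \<Longrightarrow> finite F \<Longrightarrow> F \<subseteq> X \<Longrightarrow> (\<Sum>a\<in>F. \<Sum>b\<in>F. c a * c b * K a b) \<ge> 0"
  by (simp add: psd_on_def)

lemma psd_on_cong:
  assumes "psd_on X K" "\<And>x y. x \<in> X \<Longrightarrow> y \<in> X \<Longrightarrow> K x y = K' x y"
  shows "psd_on X K'"
  unfolding psd_on_def
proof (intro allI impI)
  fix F c assume F: "finite F" "F \<subseteq> X"
  have "(\<Sum>a\<in>F. \<Sum>b\<in>F. c a * c b * K' a b) = (\<Sum>a\<in>F. \<Sum>b\<in>F. c a * c b * K a b)"
    using F(2) by (intro sum.cong refl) (simp add: assms(2) subset_iff)
  then show "(\<Sum>a\<in>F. \<Sum>b\<in>F. c a * c b * K' a b) \<ge> 0"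
    using psd_onD[OF assms(1) F] by simp
qed

lemma sum_product_square: "(\<Sum>a\<in>F. \<Sum>b\<in>F. f a * f b) = (\<Sum>a\<in>F. f a :: real)\<^sup>2"
  by (simp add: power2_eq_square sum_product)

lemma pos_def_imp_psd_on:
  assumes "pos_def_on X K"
  shows "psd_on X K"
  unfolding psd_on_def
proof (intro allI impI)
  fix F c assume F: "finite F" "F \<subseteq> X"
  show "(\<Sum>a\<in>F. \<Sum>b\<in>F. c a * c b * K a b) \<ge> 0"
  proof (cases "F = {}")
    case False
    obtain u where u: "bij_betw u {1..card F} F"
      using F(1) finite_same_card_bij[of "{1..card F}" F] by auto
    have "(\<Sum>i=1..card F. \<Sum>j=1..card F. c (u i) * c (u j) * K (u i) (u j)) \<ge> 0"
      using assms False F u unfolding pos_def_on_def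
      by (auto simp: bij_betw_def Suc_le_eq card_gt_0_iff)
    also have "(\<Sum>i=1..card F. \<Sum>j=1..card F. c (u i) * c (u j) * K (u i) (u j)) =
        (\<Sum>a\<in>F. \<Sum>b\<in>F. c a * c b * K a b)"
      by (simp only: sum.reindex_bij_betw[OF u, of "\<lambda>b. c _ * c b * K _ b"]
          sum.reindex_bij_betw[OF u, of "\<lambda>a. \<Sum>b\<in>F. c a * c b * K a b"])
    finally show ?thesis .
  qed simp
qed

lemma psd_on_one: "psd_on X (\<lambda>_ _. 1)"
  by (simp add: psd_on_def sum_product_square)

lemma psd_on_scale: "psd_on X K \<Longrightarrow> r \<ge> 0 \<Longrightarrow> psd_on X (\<lambda>x y. r * K x y)"
  unfolding psd_on_def by (simp add: mult.left_commute[of _ r] flip: sum_distrib_left)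

text \<open>A case of the Schur product theorem: the inner product is expanded in coordinates, and
  each coordinate is absorbed into the weights.\<close>

lemma psd_on_mult_one_plus_inner:
  fixes X :: "'a::euclidean_space set"
  assumes "psd_on X K"
  shows "psd_on X (\<lambda>x y. K x y * (1 + x \<bullet> y))"
  unfolding psd_on_def
proof (intro allI impI)
  fix F c assume F: "finite F" "F \<subseteq> X"
  have "(\<Sum>a\<in>F. \<Sum>b\<in>F. c a * c b * (K a b * (1 + a \<bullet> b))) =
      (\<Sum>a\<in>F. \<Sum>b\<in>F. c a * c b * K a b) +
      (\<Sum>a\<in>F. \<Sum>b\<in>F. \<Sum>i\<in>Basis. (c a * (a \<bullet> i)) * (c b * (b \<bullet> i)) * K a b)"
    unfolding sum.distrib[symmetric]
    by (intro sum.cong refl)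
      (subst euclidean_inner, simp add: sum_distrib_left distrib_left mult_ac)
  also have "(\<Sum>a\<in>F. \<Sum>b\<in>F. \<Sum>i\<in>Basis. (c a * (a \<bullet> i)) * (c b * (b \<bullet> i)) * K a b) =
      (\<Sum>i\<in>Basis. \<Sum>a\<in>F. \<Sum>b\<in>F. (c a * (a \<bullet> i)) * (c b * (b \<bullet> i)) * K a b)"
    by (simp only: sum.swap[of _ "Basis :: 'a set"])
  also have "(\<Sum>a\<in>F. \<Sum>b\<in>F. c a * c b * K a b) + \<dots> \<ge> 0"
    using F by (intro add_nonneg_nonneg sum_nonneg[of "Basis :: 'a set"] psd_onD[OF assms])
  finally show "(\<Sum>a\<in>F. \<Sum>b\<in>F. c a * c b * (K a b * (1 + a \<bullet> b))) \<ge> 0" .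
qed

text \<open>Simple functions converging to the identity are projected radially, so that all their
  values are admissible points for a kernel on the sphere.\<close>

lemma sphere_simple_approximation:
  "\<exists>T :: nat \<Rightarrow> 'a::euclidean_space \<Rightarrow> 'a. (\<forall>i. simple_function sphere_measure (T i)) \<and>
     (\<forall>i x. norm (T i x) = 1) \<and> (\<forall>x. norm x = 1 \<longrightarrow> (\<lambda>i. T i x) \<longlonglongrightarrow> x)"
proof -
  obtain F :: "nat \<Rightarrow> 'a \<Rightarrow> 'a" where "\<forall>i. simple_function sphere_measure (F i)"
      "\<forall>x\<in>space sphere_measure. (\<lambda>i. F i x) \<longlonglongrightarrow> x"
    using borel_measurable_implies_sequence_metric[OF borel_measurable_sphere_measure_id, of 0] by blast
  then have F: "\<And>i. simple_function sphere_measure (F i)"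
      "\<And>x. norm x = 1 \<Longrightarrow> (\<lambda>i. F i x) \<longlonglongrightarrow> x"
    by auto
  have "(\<lambda>i. unit_direction (F i x)) \<longlonglongrightarrow> x" if x: "norm x = 1" for x
  proof -
    have "x \<noteq> 0" "sgn x = x" using x by (auto simp: sgn_div_norm)
    then have "(\<lambda>i. sgn (F i x)) \<longlonglongrightarrow> x"
      using tendsto_sgn[OF F(2)[OF x]] by simp
    moreover have "\<forall>\<^sub>F i in sequentially. F i x \<noteq> 0"
      using tendsto_imp_eventually_ne[OF F(2)[OF x] \<open>x \<noteq> 0\<close>] .
    then have "\<forall>\<^sub>F i in sequentially. sgn (F i x) = unit_direction (F i x)"
      by eventually_elim (simp add: unit_direction_def)
    ultimately show ?thesis
      by (rule Lim_transform_eventually)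
  qed
  then show ?thesis
    using simple_function_compose1[OF F(1), of unit_direction]
    by (intro exI[of _ "\<lambda>i x. unit_direction (F i x)"]) auto
qed

section \<open>Averages of positive semidefinite kernels\<close>

context round_sphere
begin

lemma integral_simple_value:
  fixes T :: "'a \<Rightarrow> 'a" and h :: "'a \<Rightarrow> real"
  assumes T: "simple_function sphere_measure T"
  shows "(\<integral>v. h (T v) \<partial>sphere_measure) =
     (\<Sum>b\<in>T ` sphere 0 1. h b * measure sphere_measure (T -` {b} \<inter> sphere 0 1))"
proof -
  let ?A = "\<lambda>b. T -` {b} \<inter> sphere 0 1"
  have sets: "?A b \<in> sets sphere_measure" if "b \<in> T ` sphere 0 1" for b
    using T that by (auto simp: simple_function_def)
  have fin: "finite (T ` sphere 0 1)"
    using T by (simp add: simple_function_def)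
  have "(\<integral>v. h (T v) \<partial>sphere_measure) =
      (\<integral>v. (\<Sum>b\<in>T ` sphere 0 1. h b * indicator (?A b) v) \<partial>sphere_measure)"
  proof (rule Bochner_Integration.integral_cong[OF refl])
    fix v :: 'a assume "v \<in> space sphere_measure"
    then have v: "v \<in> sphere 0 1" by simp
    have "(\<Sum>b\<in>T ` sphere 0 1. h b * indicator (?A b) v) = (\<Sum>b\<in>T ` sphere 0 1. if b = T v then h b else 0)"
      using v by (intro sum.cong) (auto simp: indicator_def)
    then show "h (T v) = (\<Sum>b\<in>T ` sphere 0 1. h b * indicator (?A b) v)"
      using fin v by (simp add: sum.delta)
  qed
  also have "\<dots> = (\<Sum>b\<in>T ` sphere 0 1. (\<integral>v. h b * indicator (?A b) v \<partial>sphere_measure))"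
    using sets by (intro Bochner_Integration.integral_sum integrable_mult_right)
      (auto simp: less_top[symmetric])
  also have "\<dots> = (\<Sum>b\<in>T ` sphere 0 1. h b * measure sphere_measure (?A b))"
    using sets by (intro sum.cong) auto
  finally show ?thesis .
qed

text \<open>With both variables replaced by simple approximations the integral is a quadratic form
  whose weights are the measures of the level sets. Dominated convergence, applied to the inner and
  then to the outer integral, gives the limit.\<close>

lemma psd_double_integral_nonneg:
  fixes K :: "'a \<Rightarrow> 'a \<Rightarrow> real"
  assumes K: "continuous_on (sphere 0 1 \<times> sphere 0 1) (\<lambda>(x, y). K x y)" and psd: "psd_on (sphere 0 1) K"
  shows "(\<integral>u. \<integral>v. K u v \<partial>sphere_measure \<partial>sphere_measure) \<ge> 0"
proof -
  obtain T :: "nat \<Rightarrow> 'a \<Rightarrow> 'a" where T: "\<And>i. simple_function sphere_measure (T i)"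
      "\<And>i x. norm (T i x) = 1" "\<And>x. norm x = 1 \<Longrightarrow> (\<lambda>i. T i x) \<longlonglongrightarrow> x"
    using sphere_simple_approximation by blast
  have "bounded ((\<lambda>(x, y). K x y) ` (sphere 0 1 \<times> sphere 0 1))"
    using K by (intro compact_imp_bounded compact_continuous_image compact_Times) auto
  then obtain B where "\<forall>z\<in>sphere 0 1 \<times> sphere 0 1. norm (case z of (x, y) \<Rightarrow> K x y) \<le> B"
    by (auto simp: bounded_iff)
  then have B: "\<bar>K x y\<bar> \<le> B" if "norm x = 1" "norm y = 1" for x y
    using that by auto
  have lim: "(\<lambda>i. K (T i u) (T i v)) \<longlonglongrightarrow> K u v" if "norm u = 1" "norm v = 1" for u v
  proof -
    have "(\<lambda>i. (T i u, T i v)) \<longlonglongrightarrow> (u, v)"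
      using T(3) that by (intro tendsto_Pair)
    then have "(\<lambda>i. case (T i u, T i v) of (x, y) \<Rightarrow> K x y) \<longlonglongrightarrow> (case (u, v) of (x, y) \<Rightarrow> K x y)"
      by (rule continuous_on_tendsto_compose[OF K]) (use T(2) that in auto)
    then show ?thesis by simp
  qed
  have meas: "(\<lambda>v. h (T i v)) \<in> borel_measurable sphere_measure" for h :: "'a \<Rightarrow> real" and i
    by (intro borel_measurable_simple_function simple_function_compose1[OF T(1)])
  have inner: "(\<lambda>i. \<integral>v. K (T i u) (T i v) \<partial>sphere_measure) \<longlonglongrightarrow> (\<integral>v. K u v \<partial>sphere_measure)"
    if u: "norm u = 1" for u
  proof (rule integral_dominated_convergence[where w = "\<lambda>_. B"])
    have "continuous_on (sphere 0 1) (\<lambda>v. case (u, v) of (x, y) \<Rightarrow> K x y)"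
      using u by (intro continuous_on_compose2[OF K]) (auto intro!: continuous_intros)
    then show "K u \<in> borel_measurable sphere_measure"
      using borel_measurable_integrable[OF integrable_sphere_measure] by auto
  qed (use meas lim u T(2) B in auto)
  have bound: "\<bar>\<integral>v. K (T i u) (T i v) \<partial>sphere_measure\<bar> \<le> B" if "norm u = 1" for u i
  proof -
    have "B \<ge> 0" using B[OF norm_e norm_e] by linarith
    have "\<bar>\<integral>v. K (T i u) (T i v) \<partial>sphere_measure\<bar> \<le> (\<integral>v. \<bar>K (T i u) (T i v)\<bar> \<partial>sphere_measure)"
      by (rule integral_abs_bound)
    also have "\<dots> \<le> (\<integral>v. B \<partial>(sphere_measure :: 'a measure))"
      using B T(2) \<open>B \<ge> 0\<close> by (intro integral_mono') auto
    finally show ?thesis using prob_space by simp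
  qed
  have outer: "(\<lambda>i. \<integral>u. \<integral>v. K (T i u) (T i v) \<partial>sphere_measure \<partial>sphere_measure) \<longlonglongrightarrow>
      (\<integral>u. \<integral>v. K u v \<partial>sphere_measure \<partial>sphere_measure)"
  proof (rule integral_dominated_convergence[where w = "\<lambda>_. B"])
    show m: "(\<lambda>u. \<integral>v. K (T i u) (T i v) \<partial>sphere_measure) \<in> borel_measurable sphere_measure" for i
      by (rule meas)
    show "(\<lambda>u. \<integral>v. K u v \<partial>sphere_measure) \<in> borel_measurable sphere_measure"
      by (rule borel_measurable_LIMSEQ_real[OF _ m]) (use inner in auto)
  qed (use inner bound in auto)
  have "(\<integral>u. \<integral>v. K (T i u) (T i v) \<partial>sphere_measure \<partial>sphere_measure) \<ge> 0" for i
  proof -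
    let ?m = "\<lambda>b. measure sphere_measure (T i -` {b} \<inter> sphere 0 1)"
    have "(\<integral>u. \<integral>v. K (T i u) (T i v) \<partial>sphere_measure \<partial>sphere_measure) =
      (\<Sum>a\<in>T i ` sphere 0 1. \<Sum>b\<in>T i ` sphere 0 1. ?m a * ?m b * K a b)"
      using integral_simple_value[OF T(1), of "\<lambda>a. \<integral>v. K a (T i v) \<partial>sphere_measure" i]
      by (simp add: integral_simple_value[OF T(1), of "K a" for a] sum_distrib_left mult_ac)
    also have "\<dots> \<ge> 0"
      using T by (intro psd_onD[OF psd]) (auto simp: simple_function_def)
    finally show ?thesis .
  qed
  with outer show ?thesis
    by (intro LIMSEQ_le_const) auto
qed

text \<open>By the reproducing formula the form is, up to the factor \<open>znorm l\<close>, the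
  mean over \<open>w\<close> of forms of \<open>K\<close> with weights
  \<open>c a * poly (zonal d l) (a \<bullet> w)\<close>.\<close>

lemma psd_on_mult_zonal:
  assumes "psd_on (sphere (0::'a) 1) K"
  shows "psd_on (sphere (0::'a) 1) (\<lambda>x y. K x y * poly (zonal d l) (x \<bullet> y))"
  unfolding psd_on_def
proof (intro allI impI)
  fix F :: "'a set" and c assume F: "finite F" "F \<subseteq> sphere 0 1"
  let ?R = "poly (zonal d l)"
  have int: "integrable sphere_measure (\<lambda>w::'a. ?R (a \<bullet> w) * ?R (b \<bullet> w))" for a b
    by (intro integrable_sphere_measure continuous_intros)
  have "znorm l * (\<Sum>a\<in>F. \<Sum>b\<in>F. c a * c b * (K a b * ?R (a \<bullet> b))) =
      (\<Sum>a\<in>F. \<Sum>b\<in>F. c a * c b * K a b * (\<integral>w. ?R (a \<bullet> w) * ?R (b \<bullet> w) \<partial>sphere_measure))"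
    unfolding sum_distrib_left
  proof (intro sum.cong refl)
    fix a b assume "a \<in> F" "b \<in> F"
    then have "norm a = 1" "norm b = 1" using F by auto
    then show "znorm l * (c a * c b * (K a b * ?R (a \<bullet> b))) =
        c a * c b * K a b * (\<integral>w. ?R (a \<bullet> w) * ?R (b \<bullet> w) \<partial>sphere_measure)"
      by (simp add: zonal_reproducing)
  qed
  also have "\<dots> = (\<integral>w. (\<Sum>a\<in>F. \<Sum>b\<in>F. (c a * ?R (a \<bullet> w)) * (c b * ?R (b \<bullet> w)) * K a b) \<partial>sphere_measure)"
  proof -
    have "(\<lambda>w. \<Sum>a\<in>F. \<Sum>b\<in>F. (c a * ?R (a \<bullet> w)) * (c b * ?R (b \<bullet> w)) * K a b) =
        (\<lambda>w. \<Sum>a\<in>F. \<Sum>b\<in>F. c a * c b * K a b * (?R (a \<bullet> w) * ?R (b \<bullet> w)))"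
      by (simp add: mult_ac)
    then show ?thesis using int by simp
  qed
  also have "\<dots> \<ge> 0"
    using F by (intro Bochner_Integration.integral_nonneg psd_onD[OF assms])
  finally show "(\<Sum>a\<in>F. \<Sum>b\<in>F. c a * c b * (K a b * ?R (a \<bullet> b))) \<ge> 0"
    using znorm_pos[of l] by (simp add: zero_le_mult_iff)
qed

lemma psd_on_zonal: "psd_on (sphere (0::'a) 1) (\<lambda>x y. poly (zonal d l) (x \<bullet> y))"
  using psd_on_mult_zonal[OF psd_on_one] by simp

text \<open>Positive semidefiniteness is tested at two points with inner product \<open>t\<close>,
  with weights (1, 1) and (1, -1). If the points coincide, the value is 1.\<close>

lemma zonal_abs_le_1:
  assumes t: "t \<in> {-1..1}"
  shows "\<bar>poly (zonal d l) t\<bar> \<le> 1"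
proof -
  let ?R = "poly (zonal d l)"
  obtain v where v: "norm v = 1" "e \<bullet> v = 0"
    using orthonormal_exists[OF norm_e] by blast
  define x where "x = t *\<^sub>R e + sqrt (1 - t\<^sup>2) *\<^sub>R v"
  have x: "norm x = 1" "e \<bullet> x = t"
    using latitude_exists[OF norm_e v t] by (simp_all add: x_def)
  show ?thesis
  proof (cases "x = e")
    case True
    then show ?thesis
      using x norm_e by (simp add: norm_eq_1 zonal_at_1[OF d])
  next
    case False
    have "(\<Sum>a\<in>{e, x}. \<Sum>b\<in>{e, x}. c a * c b * ?R (a \<bullet> b)) \<ge> 0" for c
      using x norm_e by (intro psd_onD[OF psd_on_zonal]) auto
    from this[of "\<lambda>_. 1"] this[of "\<lambda>a. if a = e then 1 else -1"]
    show ?thesis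
      using False x norm_e by (simp add: norm_eq_1 zonal_at_1[OF d] inner_commute[of x e] abs_le_iff)
  qed
qed

text \<open>In the double integral of the kernel the inner integral is the constant
  \<open>zmean \<phi>\<close>.\<close>

lemma zmean_psd_nonneg:
  assumes \<phi>: "continuous_on {-1..1} \<phi>" and psd: "psd_on (sphere (0::'a) 1) (\<lambda>x y. \<phi> (x \<bullet> y))"
  shows "zmean \<phi> \<ge> 0"
proof -
  have "continuous_on (sphere 0 1 \<times> sphere 0 1) (\<lambda>(x, y::'a). \<phi> (x \<bullet> y))"
    unfolding split_beta
  proof (rule continuous_on_compose2[OF \<phi>])
    show "(\<lambda>z. fst z \<bullet> snd z) ` (sphere 0 1 \<times> sphere (0::'a) 1) \<subseteq> {-1..1}"
      by (intro image_subsetI inner_sphere_range) auto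
  qed (intro continuous_intros)
  then have "0 \<le> (\<integral>u. \<integral>v. \<phi> (u \<bullet> (v::'a)) \<partial>sphere_measure \<partial>sphere_measure)"
    using psd by (rule psd_double_integral_nonneg)
  also have "\<dots> = (\<integral>u. zmean \<phi> \<partial>(sphere_measure :: 'a measure))"
    using \<phi> by (intro Bochner_Integration.integral_cong refl) (simp add: integral_zonal)
  finally show ?thesis
    using prob_space by simp
qed

lemma zmean_mult_zonal_nonneg:
  assumes "continuous_on {-1..1} g" and "psd_on (sphere (0::'a) 1) (\<lambda>x y. g (x \<bullet> y))"
  shows "zmean (\<lambda>t. g t * poly (zonal d l) t) \<ge> 0"
  using assms(1) psd_on_mult_zonal[OF assms(2), of l]
  by (intro zmean_psd_nonneg continuous_intros)

lemma psd_on_one_plus_inner_power: "psd_on (sphere (0::'a) 1) (\<lambda>x y. (1 + x \<bullet> y) ^ N)"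
proof (induction N)
  case (Suc N)
  then show ?case
    using psd_on_mult_one_plus_inner[OF Suc] by (simp add: mult.commute)
qed (simp add: psd_on_one)

text \<open>The polynomials \<open>((1 + t) / 2) ^ N\<close> have nonnegative zonal coefficients and concentrate at
  \<open>t = 1\<close>.\<close>

lemma nonneg_at_1:
  assumes \<phi>: "continuous_on {-1..1} \<phi>" and nonneg: "\<And>l. zmean (\<lambda>t. \<phi> t * poly (zonal d l) t) \<ge> 0"
  shows "\<phi> 1 \<ge> 0"
proof (rule ccontr)
  assume "\<not> \<phi> 1 \<ge> 0"
  define \<eta> where "\<eta> = - \<phi> 1 / 2"
  have \<eta>: "\<eta> > 0" "\<phi> 1 = - 2 * \<eta>" using \<open>\<not> \<phi> 1 \<ge> 0\<close> by (simp_all add: \<eta>_def)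
  obtain r where r: "r > 0" "\<And>t. t \<in> {-1..1} \<Longrightarrow> dist t 1 < r \<Longrightarrow> dist (\<phi> t) (\<phi> 1) < \<eta>"
    using bspec[OF \<phi>[unfolded continuous_on_iff], of 1] \<eta>(1) by auto
  \<comment> \<open>On \<open>[1 - 2 * \<delta>, 1]\<close> the function stays at or below
    \<open>- \<eta>\<close>; the bound 1/2 keeps the cutoff \<open>\<psi>\<close> below 1.\<close>
  define \<delta> where "\<delta> = min (r / 4) (1 / 2)"
  have \<delta>: "\<delta> > 0" "\<delta> \<le> 1/2" "2 * \<delta> < r" using r(1) by (auto simp: \<delta>_def min_def)
  have neg: "\<phi> t \<le> - \<eta>" if "1 - 2 * \<delta> \<le> t" "t \<le> 1" for t
    using r(2)[of t] that \<delta> \<eta>(2) by (auto simp: dist_real_def)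
  have "bounded (\<phi> ` {-1..1})"
    using \<phi> by (intro compact_imp_bounded compact_continuous_image) auto
  then obtain M where M: "\<forall>t\<in>{-1..1}. \<bar>\<phi> t\<bar> \<le> M"
    by (auto simp: bounded_iff)
  then have "\<bar>\<phi> 1\<bar> \<le> M" by simp
  then have "M \<ge> 0" by linarith
  \<comment> \<open>A continuous substitute for the indicator of \<open>t > 1 - \<delta>\<close>, so
    that \<open>zmean_pos\<close> and \<open>zmean_mono\<close> apply.\<close>
  define \<psi> where "\<psi> t = max 0 (t - (1 - \<delta>))" for t :: real
  have \<psi>: "continuous_on {-1..1} \<psi>"
    unfolding \<psi>_def[abs_def] by (intro continuous_intros)
  have \<psi>_pos: "zmean \<psi> > 0"
    using \<psi> \<delta> by (intro zmean_pos[of _ 1]) (auto simp: \<psi>_def)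
  \<comment> \<open>Against \<open>(1 + t) ^ N\<close>, whose zonal coefficients are nonnegative,
    \<open>\<phi>\<close> has nonnegative mean. Far from 1 the product is at most
    \<open>M * (2 - 2 * \<delta>) ^ N\<close>, close to 1 at most
    \<open>- (\<eta> * (2 - \<delta>) ^ N * \<psi> t)\<close>, and in between it is
    nonpositive.\<close>
  have "\<eta> * (2 - \<delta>) ^ N * zmean \<psi> \<le> M * (2 - 2 * \<delta>) ^ N" for N
  proof -
    define q :: "real poly" where "q = [:1, 1:] ^ N"
    have q: "poly q t = (1 + t) ^ N" for t by (simp add: q_def poly_power)
    have "0 \<le> pmean (q * zonal d j) / znorm j" for j
    proof -
      have "zmean (\<lambda>t. poly q t * poly (zonal d j) t) \<ge> 0"
        using psd_on_one_plus_inner_power[of N] by (intro zmean_mult_zonal_nonneg continuous_on_poly_fun) (simp add: q)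
      then show ?thesis
        using znorm_pos[of j] by (simp add: poly_mult[abs_def])
    qed
    then have "0 \<le> (\<Sum>j\<le>degree q. pmean (q * zonal d j) / znorm j * zmean (\<lambda>t. \<phi> t * poly (zonal d j) t))"
      using nonneg by (intro sum_nonneg mult_nonneg_nonneg)
    also have "\<dots> = zmean (\<lambda>t. \<Sum>j\<le>degree q. pmean (q * zonal d j) / znorm j * (\<phi> t * poly (zonal d j) t))"
      using \<phi> by (subst zmean_sum) (auto intro!: continuous_intros simp: zmean_cmult simp del: times_divide_eq_left)
    also have "\<dots> = zmean (\<lambda>t. \<phi> t * poly q t)"
      by (subst (3) zonal_expansion[OF order.refl, of q])
        (simp add: poly_sum sum_distrib_left mult_ac)
    also have "\<dots> \<le> zmean (\<lambda>t. M * (2 - 2 * \<delta>) ^ N - (\<eta> * (2 - \<delta>) ^ N) * \<psi> t)"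
    proof (rule zmean_mono)
      fix t :: real assume t: "t \<in> {-1..1}"
      consider "t < 1 - 2 * \<delta>" | "1 - 2 * \<delta> \<le> t" "t \<le> 1 - \<delta>" | "1 - \<delta> < t" by linarith
      then show "\<phi> t * poly q t \<le> M * (2 - 2 * \<delta>) ^ N - (\<eta> * (2 - \<delta>) ^ N) * \<psi> t"
      proof cases
        case 1
        have "\<phi> t * (1 + t) ^ N \<le> M * (2 - 2 * \<delta>) ^ N"
          using M t 1 \<open>M \<ge> 0\<close> by (intro mult_mono power_mono) (auto simp: abs_le_iff)
        then show ?thesis
          using 1 \<delta> by (simp add: q \<psi>_def)
      next
        case 2
        have "\<phi> t * (1 + t) ^ N \<le> 0"
          using neg[of t] 2 t \<eta> by (intro mult_nonpos_nonneg) auto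
        moreover have "0 \<le> M * (2 - 2 * \<delta>) ^ N"
          using \<open>M \<ge> 0\<close> \<delta> by simp
        ultimately show ?thesis
          using 2 by (simp add: q \<psi>_def)
      next
        case 3
        have "(2 - \<delta>) ^ N * \<psi> t \<le> (1 + t) ^ N * 1"
          using 3 \<delta> t by (intro mult_mono power_mono) (auto simp: \<psi>_def)
        then have "\<eta> * ((2 - \<delta>) ^ N * \<psi> t) \<le> \<eta> * (1 + t) ^ N"
          using \<eta> by simp
        also have "\<dots> \<le> (- \<phi> t) * (1 + t) ^ N"
          using neg[of t] 3 \<delta> t by (intro mult_right_mono) auto
        finally have "\<phi> t * (1 + t) ^ N \<le> - (\<eta> * (2 - \<delta>) ^ N * \<psi> t)"
          by simp
        moreover have "0 \<le> M * (2 - 2 * \<delta>) ^ N"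
          using \<open>M \<ge> 0\<close> \<delta> by simp
        ultimately show ?thesis
          by (simp add: q)
      qed
    qed (use \<phi> \<psi> in \<open>auto intro!: continuous_intros\<close>)
    also have "\<dots> = M * (2 - 2 * \<delta>) ^ N - \<eta> * (2 - \<delta>) ^ N * zmean \<psi>"
      using \<psi> by (subst zmean_diff) (auto intro!: continuous_intros simp: zmean_cmult)
    finally show ?thesis by simp
  qed
  \<comment> \<open>The ratio on the right is below 1, so letting \<open>N\<close> tend to infinity
    contradicts the positivity of the left side.\<close>
  then have "\<eta> * zmean \<psi> \<le> M * ((2 - 2 * \<delta>) / (2 - \<delta>)) ^ N" for N
    using \<delta> by (simp add: power_divide field_simps)
  moreover have "(\<lambda>N. M * ((2 - 2 * \<delta>) / (2 - \<delta>)) ^ N) \<longlonglongrightarrow> M * 0"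
    using \<delta> by (intro tendsto_intros LIMSEQ_power_zero) auto
  ultimately have "\<eta> * zmean \<psi> \<le> 0"
    by (metis LIMSEQ_le_const mult_zero_right)
  then show False
    using \<eta>(1) \<psi>_pos by (simp add: mult_le_0_iff)
qed

end

section \<open>Schoenberg's theorem\<close>

lemma Weierstrass_poly:
  fixes f :: "real \<Rightarrow> real"
  assumes "compact S" "continuous_on S f" "0 < \<epsilon>"
  shows "\<exists>p. \<forall>x\<in>S. \<bar>f x - poly p x\<bar> < \<epsilon>"
proof -
  obtain g where g: "real_polynomial_function g" "\<And>x. x \<in> S \<Longrightarrow> \<bar>f x - g x\<bar> < \<epsilon>"
    using Stone_Weierstrass_real_polynomial_function[OF assms] by blast
  then obtain a n where "g = (\<lambda>x. \<Sum>i\<le>n. a i * x ^ i)"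
    using real_polynomial_function_imp_sum by blast
  then have "g = poly (\<Sum>i\<le>n. monom (a i) i)"
    by (auto simp: poly_sum poly_monom)
  with g show ?thesis by blast
qed

context round_sphere
begin

lemma zmean_abs_le:
  assumes "continuous_on {-1..1} \<phi>" "\<And>t. t \<in> {-1..1} \<Longrightarrow> \<bar>\<phi> t\<bar> \<le> B"
  shows "\<bar>zmean \<phi>\<bar> \<le> B"
proof -
  have "- B \<le> \<phi> t \<and> \<phi> t \<le> B" if "t \<in> {-1..1}" for t
    using assms(2)[OF that] by linarith
  then have "zmean \<phi> \<le> zmean (\<lambda>_. B)" "zmean (\<lambda>_. - B) \<le> zmean \<phi>"
    using assms(1) by (intro zmean_mono; simp)+
  then show ?thesis by (simp add: abs_le_iff)
qed

text \<open>\<open>D\<close> is orthogonal to all polynomials, hence by Weierstrass approximation to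
  itself; a continuous square with mean zero vanishes by \<open>zmean_pos\<close>.\<close>

lemma zonal_complete:
  assumes D: "continuous_on {-1..1} D" and orth: "\<And>j. zmean (\<lambda>t. D t * poly (zonal d j) t) = 0"
    and t: "t \<in> {-1..1}"
  shows "D t = 0"
proof -
  have poly0: "zmean (\<lambda>t. D t * poly p t) = 0" for p
  proof -
    have "zmean (\<lambda>t. D t * poly p t) =
        zmean (\<lambda>t. \<Sum>j\<le>degree p. (pmean (p * zonal d j) / znorm j) * (D t * poly (zonal d j) t))"
      by (subst zonal_expansion[OF order.refl, of p]) (simp add: poly_sum sum_distrib_left mult_ac)
    also have "\<dots> = (\<Sum>j\<le>degree p. zmean (\<lambda>t. (pmean (p * zonal d j) / znorm j) * (D t * poly (zonal d j) t)))"
      using D by (intro zmean_sum continuous_intros)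
    also have "\<dots> = 0"
      by (intro sum.neutral ballI) (simp only: zmean_cmult orth mult_zero_right)
    finally show ?thesis .
  qed
  have "bounded (D ` {-1..1})"
    using D by (intro compact_imp_bounded compact_continuous_image) auto
  then obtain B where B: "\<forall>t\<in>{-1..1}. \<bar>D t\<bar> \<le> B"
    by (auto simp: bounded_iff)
  have approx: "zmean (\<lambda>t. D t * D t) \<le> \<epsilon> * B" if "\<epsilon> > 0" for \<epsilon>
  proof -
    obtain p where p: "\<forall>t\<in>{-1..1}. \<bar>D t - poly p t\<bar> < \<epsilon>"
      using Weierstrass_poly[OF compact_Icc D \<open>\<epsilon> > 0\<close>] by blast
    have "zmean (\<lambda>t. D t * D t) = zmean (\<lambda>t. (D t - poly p t) * D t)"
      using zmean_diff[of "\<lambda>t. D t * D t" "\<lambda>t. D t * poly p t"] D poly0[of p]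
      by (simp add: continuous_on_mult algebra_simps)
    also have "\<dots> \<le> \<bar>zmean (\<lambda>t. (D t - poly p t) * D t)\<bar>" by simp
    also have "\<dots> \<le> \<epsilon> * B"
    proof (rule zmean_abs_le)
      fix t :: real assume "t \<in> {-1..1}"
      then show "\<bar>(D t - poly p t) * D t\<bar> \<le> \<epsilon> * B"
        using p B \<open>\<epsilon> > 0\<close> unfolding abs_mult by (intro mult_mono) (auto simp: less_imp_le)
    qed (use D in \<open>auto intro!: continuous_intros\<close>)
    finally show ?thesis .
  qed
  have "zmean (\<lambda>t. D t * D t) \<le> 0 + \<epsilon>" if "\<epsilon> > 0" for \<epsilon>
  proof -
    \<comment> \<open>The summand 1 in the denominator guards against \<open>B = 0\<close>.\<close>
    have "zmean (\<lambda>t. D t * D t) \<le> \<epsilon> / (\<bar>B\<bar> + 1) * B"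
      using that by (intro approx) simp
    also have "\<dots> \<le> \<epsilon> / (\<bar>B\<bar> + 1) * (\<bar>B\<bar> + 1)"
      using that by (intro mult_left_mono) auto
    also have "\<dots> = 0 + \<epsilon>"
      using abs_ge_zero[of B] by (simp add: field_simps)
    finally show ?thesis .
  qed
  then have "zmean (\<lambda>t. D t * D t) \<le> 0"
    by (rule field_le_epsilon)
  then show "D t = 0"
    using zmean_pos[of "\<lambda>t. D t * D t" t] D t
    by (metis continuous_on_mult not_less not_real_square_gt_zero zero_le_square)
qed

theorem Schoenberg_expansion:
  assumes g: "continuous_on {-1..1} g" and psd: "psd_on (sphere (0::'a) 1) (\<lambda>x y. g (x \<bullet> y))"
  shows "\<exists>b. (\<forall>l. b l \<ge> 0) \<and> summable b \<and> (\<forall>t\<in>{-1..1}. (\<lambda>l. b l * poly (zonal d l) t) sums g t)"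
proof -
  let ?R = "\<lambda>l. poly (zonal d l)"
  define b where "b l = zmean (\<lambda>t. g t * ?R l t) / znorm l" for l
  have b_nonneg: "b l \<ge> 0" for l
    using zmean_mult_zonal_nonneg[OF g psd, of l] znorm_pos[of l] by (simp add: b_def)
  define s where "s N t = (\<Sum>l<N. b l * ?R l t)" for N t
  have s_cont: "continuous_on A (s N)" for A N
    unfolding s_def[abs_def] by (intro continuous_intros)
  \<comment> \<open>Subtracting the partial sum deletes the first \<open>N\<close> coefficients and
    leaves the others nonnegative, so that \<open>nonneg_at_1\<close> applies to the
    remainder.\<close>
  have rest: "zmean (\<lambda>t. (g t - s N t) * ?R j t) = (if j < N then 0 else b j * znorm j)" for N j
  proof -
    have "zmean (\<lambda>t. (g t - s N t) * ?R j t) = zmean (\<lambda>t. g t * ?R j t - s N t * ?R j t)"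
      by (simp add: algebra_simps)
    also have "\<dots> = zmean (\<lambda>t. g t * ?R j t) - zmean (\<lambda>t. s N t * ?R j t)"
      using g s_cont by (intro zmean_diff continuous_intros)
    also have "zmean (\<lambda>t. s N t * ?R j t) = zmean (\<lambda>t. \<Sum>l<N. b l * poly (zonal d l * zonal d j) t)"
      by (simp add: s_def sum_distrib_right mult.assoc)
    also have "\<dots> = (\<Sum>l<N. b l * pmean (zonal d l * zonal d j))"
      by (subst zmean_sum) (simp_all add: zmean_cmult continuous_on_mult del: poly_mult)
    also have "\<dots> = (\<Sum>l<N. if l = j then b j * znorm j else 0)"
      by (intro sum.cong) (auto simp: pmean_zonal_zonal)
    also have "zmean (\<lambda>t. g t * ?R j t) = b j * znorm j"
      using znorm_pos[of j] by (simp add: b_def)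
    finally show ?thesis by simp
  qed
  have bounded: "(\<Sum>l<N. b l) \<le> g 1" for N
  proof -
    have "zmean (\<lambda>t. (g t - s N t) * ?R j t) \<ge> 0" for j
      unfolding rest using b_nonneg[of j] znorm_pos[of j] by simp
    then have "g 1 - s N 1 \<ge> 0"
      using g s_cont by (intro nonneg_at_1[of "\<lambda>t. g t - s N t"] continuous_intros)
    then show ?thesis
      by (simp add: s_def zonal_at_1[OF d])
  qed
  have summ: "summable b"
    using b_nonneg bounded by (rule summableI_nonneg_bounded)
  define G where "G t = (\<Sum>l. b l * ?R l t)" for t
  have unif: "uniform_limit {-1..1} s G sequentially"
    unfolding s_def[abs_def] G_def[abs_def]
  proof (rule Weierstrass_m_test[OF _ summ])
    fix l and t :: real assume "t \<in> {-1..1}"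
    then show "norm (b l * ?R l t) \<le> b l"
      using zonal_abs_le_1[of t l] b_nonneg[of l] mult_left_mono by (fastforce simp: abs_mult)
  qed
  have G: "continuous_on {-1..1} G"
    by (rule uniform_limit_theorem[OF _ unif]) (auto simp: s_cont)
  have "g t - G t = 0" if t: "t \<in> {-1..1}" for t
  proof (rule zonal_complete[OF _ _ t])
    show "continuous_on {-1..1} (\<lambda>t. g t - G t)"
      using g G by (rule continuous_on_diff)
    fix j
    \<comment> \<open>For \<open>N > j\<close> the remainder \<open>g - s N\<close> is already
      orthogonal to \<open>zonal d j\<close>, and \<open>s N - G\<close> is uniformly small.\<close>
    have "\<bar>zmean (\<lambda>t. (g t - G t) * ?R j t)\<bar> \<le> 0 + \<epsilon>" if "\<epsilon> > 0" for \<epsilon>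
    proof -
      have "\<forall>\<^sub>F N in sequentially. \<forall>t\<in>{-1..1}. dist (s N t) (G t) < \<epsilon>"
        using unif that by (rule uniform_limitD)
      then have "\<forall>\<^sub>F N in sequentially. (\<forall>t\<in>{-1..1}. dist (s N t) (G t) < \<epsilon>) \<and> j < N"
        using eventually_gt_at_top[of j] by (rule eventually_conj)
      then obtain N where N: "\<forall>t\<in>{-1..1}. dist (s N t) (G t) < \<epsilon>" "j < N"
        by (metis (mono_tags, lifting) eventually_sequentially order.refl)
      have "zmean (\<lambda>t. (g t - G t) * ?R j t) =
          zmean (\<lambda>t. (g t - s N t) * ?R j t + (s N t - G t) * ?R j t)"
        by (simp add: algebra_simps)
      also have "\<dots> = zmean (\<lambda>t. (g t - s N t) * ?R j t) + zmean (\<lambda>t. (s N t - G t) * ?R j t)"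
        using g G s_cont by (intro zmean_add continuous_intros)
      also have "\<dots> = zmean (\<lambda>t. (s N t - G t) * ?R j t)"
        using N(2) by (simp add: rest)
      finally have "\<bar>zmean (\<lambda>t. (g t - G t) * ?R j t)\<bar> = \<bar>zmean (\<lambda>t. (s N t - G t) * ?R j t)\<bar>"
        by simp
      also have "\<dots> \<le> \<epsilon>"
      proof (rule zmean_abs_le)
        fix t :: real assume t: "t \<in> {-1..1}"
        have "\<bar>(s N t - G t) * ?R j t\<bar> \<le> \<epsilon> * 1"
          unfolding abs_mult using N(1) t zonal_abs_le_1[OF t, of j] that
          by (intro mult_mono) (auto simp: dist_real_def less_imp_le)
        then show "\<bar>(s N t - G t) * ?R j t\<bar> \<le> \<epsilon>" by simp
      qed (use s_cont G in \<open>auto intro!: continuous_intros\<close>)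
      finally show ?thesis by simp
    qed
    then have "\<bar>zmean (\<lambda>t. (g t - G t) * ?R j t)\<bar> \<le> 0"
      by (rule field_le_epsilon)
    then show "zmean (\<lambda>t. (g t - G t) * ?R j t) = 0" by simp
  qed
  moreover have "(\<lambda>l. b l * ?R l t) sums G t" if "t \<in> {-1..1}" for t
    using tendsto_uniform_limitI[OF unif that] by (simp add: sums_def s_def)
  ultimately show ?thesis
    using b_nonneg summ by (intro exI[of _ b]) auto
qed

text \<open>\<open>sphere_support\<close> quantifies existentially over coefficient families, so it
  carries information only once such a family is known to exist. Division by
  \<open>sphere_poly d l 1\<close> converts the normalization.\<close>

lemma sphere_coeffs_exist:
  assumes g: "continuous_on {-1..1} g" and psd: "psd_on (sphere (0::'a) 1) (\<lambda>x y. g (x \<bullet> y))"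
  shows "\<exists>a. sphere_coeffs d g a"
proof -
  obtain b where b: "\<And>l. b l \<ge> 0" "summable b" "\<And>t. t \<in> {-1..1} \<Longrightarrow> (\<lambda>l. b l * poly (zonal d l) t) sums g t"
    using Schoenberg_expansion[OF assms] by blast
  have P: "sphere_poly d l 1 > 0" for l
    using d by (rule sphere_poly_at_1_pos)
  have e: "b l / sphere_poly d l 1 * sphere_poly d l t = b l * poly (zonal d l) t" if "t \<in> {-1..1}" for l t
    using P[of l] by (simp add: sphere_poly_zonal[OF d that, of l])
  have "sphere_coeffs d g (\<lambda>l. b l / sphere_poly d l 1)"
    unfolding sphere_coeffs_def
  proof (intro conjI allI ballI)
    show "summable (\<lambda>l. b l / sphere_poly d l 1 * sphere_poly d l 1)"
      using b(2) by (subst e) (simp_all add: zonal_at_1[OF d])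
    show "(\<lambda>l. b l / sphere_poly d l 1 * sphere_poly d l t) sums g t" if "t \<in> {-1..1}" for t
      using b(3) that by (simp only: e)
  qed (use b(1) P in \<open>simp add: less_imp_le\<close>)
  then show ?thesis by blast
qed

lemma psd_on_sphere_poly: "psd_on (sphere (0::'a) 1) (\<lambda>x y. sphere_poly d l (x \<bullet> y))"
proof -
  have "psd_on (sphere (0::'a) 1) (\<lambda>x y. sphere_poly d l 1 * poly (zonal d l) (x \<bullet> y))"
    by (intro psd_on_scale psd_on_zonal less_imp_le sphere_poly_at_1_pos d)
  then show ?thesis
  proof (rule psd_on_cong)
    fix x y :: 'a assume "x \<in> sphere 0 1" "y \<in> sphere 0 1"
    then have "x \<bullet> y \<in> {-1..1}"
      by (intro inner_sphere_range) simp_all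
    then show "sphere_poly d l 1 * poly (zonal d l) (x \<bullet> y) = sphere_poly d l (x \<bullet> y)"
      by (rule sphere_poly_zonal[OF d, symmetric])
  qed
qed

end

section \<open>Products with the circle\<close>

text \<open>\<open>axis undefined 1\<close> is just some unit vector that serves as the
  pole.\<close>

lemma round_sphere_vec:
  assumes "CARD('n::finite) = Suc d" "d \<ge> 1"
  shows "round_sphere (axis undefined 1 :: real^'n) d"
  using assms by unfold_locales (simp_all add: norm_axis_1)

text \<open>Weights are transported from an enumeration to its set of points; the contrapositive
  form suits an argument that shows the weights to vanish.\<close>

lemma strictly_pos_def_onI:
  assumes pd: "pos_def_on X K"
    and strict: "\<And>F c. finite F \<Longrightarrow> F \<subseteq> X \<Longrightarrow> (\<Sum>a\<in>F. \<Sum>b\<in>F. c a * c b * K a b) = 0 \<Longrightarrow> \<forall>a\<in>F. c a = 0"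
  shows "strictly_pos_def_on X K"
  unfolding strictly_pos_def_on_def
proof (intro conjI allI impI pd)
  fix n and u :: "nat \<Rightarrow> 'a" and c :: "nat \<Rightarrow> real"
  assume n: "1 \<le> n" and u: "u ` {1..n} \<subseteq> X \<and> inj_on u {1..n} \<and> (\<exists>i\<in>{1..n}. c i \<noteq> 0)"
  let ?I = "{1..n}"
  define c' where "c' x = c (inv_into ?I u x)" for x
  have c': "c' (u i) = c i" if "i \<in> ?I" for i
    using u that by (simp add: c'_def inv_into_f_f)
  have "(\<Sum>i\<in>?I. \<Sum>j\<in>?I. c i * c j * K (u i) (u j)) \<ge> 0"
    using pd n u unfolding pos_def_on_def by blast
  moreover have "(\<Sum>i\<in>?I. \<Sum>j\<in>?I. c i * c j * K (u i) (u j)) \<noteq> 0"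
  proof
    assume z: "(\<Sum>i\<in>?I. \<Sum>j\<in>?I. c i * c j * K (u i) (u j)) = 0"
    have "(\<Sum>a\<in>u ` ?I. \<Sum>b\<in>u ` ?I. c' a * c' b * K a b) = (\<Sum>i\<in>?I. \<Sum>j\<in>?I. c i * c j * K (u i) (u j))"
      using u by (simp add: sum.reindex c')
    then have "\<forall>a\<in>u ` ?I. c' a = 0"
      using u z by (intro strict) auto
    then show False
      using u c' by auto
  qed
  ultimately show "(\<Sum>i\<in>?I. \<Sum>j\<in>?I. c i * c j * K (u i) (u j)) > 0"
    by linarith
qed

lemma strictly_pos_def_onD:
  assumes spd: "strictly_pos_def_on X K" and F: "finite F" "F \<subseteq> X"
    and zero: "(\<Sum>a\<in>F. \<Sum>b\<in>F. c a * c b * K a b) = 0" and "a \<in> F"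
  shows "c a = 0"
proof (rule ccontr)
  assume "c a \<noteq> 0"
  obtain u where u: "bij_betw u {1..card F} F"
    using F(1) finite_same_card_bij[of "{1..card F}" F] by auto
  have "\<exists>i\<in>{1..card F}. c (u i) \<noteq> 0"
    using u \<open>a \<in> F\<close> \<open>c a \<noteq> 0\<close> by (metis bij_betw_iff_bijections)
  moreover have "card F \<ge> 1"
    using F(1) \<open>a \<in> F\<close> by (metis One_nat_def Suc_leI card_gt_0_iff empty_iff)
  moreover have "u ` {1..card F} \<subseteq> X" "inj_on u {1..card F}"
    using u F(2) by (simp_all add: bij_betw_def)
  ultimately have "(\<Sum>i=1..card F. \<Sum>j=1..card F. c (u i) * c (u j) * K (u i) (u j)) > 0"
    using conjunct2[OF spd[unfolded strictly_pos_def_on_def], rule_format, of "card F" u "\<lambda>i. c (u i)"]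
    by blast
  also have "(\<Sum>i=1..card F. \<Sum>j=1..card F. c (u i) * c (u j) * K (u i) (u j)) =
      (\<Sum>a\<in>F. \<Sum>b\<in>F. c a * c b * K a b)"
    by (simp only: sum.reindex_bij_betw[OF u, of "\<lambda>b. c _ * c b * K _ b"]
        sum.reindex_bij_betw[OF u, of "\<lambda>a. \<Sum>b\<in>F. c a * c b * K a b"])
  finally show False
    using zero by simp
qed

text \<open>This is how membership in \<open>SPD_sphere\<close> is exploited: coefficients of the
  witness outside \<open>I\<close> are zero, so its quadratic form is a series of zeros, and
  strictness applies.\<close>

lemma SPD_sphere_vanishing:
  fixes F :: "(real^'n) set"
  assumes n: "CARD('n::finite) = Suc d" "d \<ge> 1" and I: "I \<in> SPD_sphere TYPE('n)"
    and F: "finite F" "F \<subseteq> sphere 0 1"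
    and zero: "\<And>l. l \<in> I \<Longrightarrow> (\<Sum>a\<in>F. \<Sum>b\<in>F. c a * c b * sphere_poly d l (a \<bullet> b)) = 0"
    and "a \<in> F"
  shows "c a = 0"
proof -
  interpret round_sphere "axis undefined 1 :: real^'n" d
    using n by (rule round_sphere_vec)
  obtain g where g: "continuous_on {-1..1} g"
      "strictly_pos_def_on (sphere (0::real^'n) 1) (\<lambda>z w. g (z \<bullet> w))" "sphere_support d g = I"
    using I n by (auto simp: SPD_sphere_def)
  have "psd_on (sphere (0::real^'n) 1) (\<lambda>z w. g (z \<bullet> w))"
    using g(2) by (intro pos_def_imp_psd_on) (simp add: strictly_pos_def_on_def)
  then obtain b where b: "sphere_coeffs d g b"
    using sphere_coeffs_exist[OF g(1)] by blast
  have terms: "b l * (\<Sum>a\<in>F. \<Sum>b\<in>F. c a * c b * sphere_poly d l (a \<bullet> b)) = 0" for l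
  proof (cases "b l > 0")
    case True
    then have "l \<in> I" using b g(3) by (auto simp: sphere_support_def)
    then show ?thesis by (simp add: zero)
  next
    case False
    then have "b l = 0" using b by (auto simp: sphere_coeffs_def not_less intro: antisym)
    then show ?thesis by simp
  qed
  have "(\<lambda>l. \<Sum>x\<in>F. \<Sum>y\<in>F. c x * c y * (b l * sphere_poly d l (x \<bullet> y))) sums
      (\<Sum>x\<in>F. \<Sum>y\<in>F. c x * c y * g (x \<bullet> y))"
  proof (intro sums_sum sums_mult)
    fix x y assume "x \<in> F" "y \<in> F"
    then have "x \<bullet> y \<in> {-1..1}" using F(2) by (intro inner_sphere_range) auto
    then show "(\<lambda>l. b l * sphere_poly d l (x \<bullet> y)) sums g (x \<bullet> y)"
      using b by (simp add: sphere_coeffs_def)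
  qed
  moreover have "(\<Sum>x\<in>F. \<Sum>y\<in>F. c x * c y * (b l * sphere_poly d l (x \<bullet> y))) = 0" for l
    using terms[of l] by (simp only: sum_distrib_left mult.left_commute[of "b l"])
  ultimately have "(\<Sum>x\<in>F. \<Sum>y\<in>F. c x * c y * g (x \<bullet> y)) = 0"
    by (simp add: sums_iff)
  then show ?thesis
    by (rule strictly_pos_def_onD[OF g(2) F _ \<open>a \<in> F\<close>])
qed

text \<open>In terms of angles this is the addition formula for the cosine. Each summand is a
  product of one factor per point, so the circle variable can be absorbed into the weights.\<close>

lemma circle_poly_split:
  "\<exists>C S. \<forall>x\<in>sphere (0::real^2) 1. \<forall>y\<in>sphere 0 1.
     sphere_poly 1 k (x \<bullet> y) = sphere_poly 1 k 1 * (C x * C y + S x * S y)"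
proof -
  have "\<exists>\<theta>. x $ 1 = cos \<theta> \<and> x $ 2 = sin \<theta>" if "x \<in> sphere 0 1" for x :: "real^2"
  proof -
    have "x \<bullet> x = 1" using that by (simp add: norm_eq_1)
    then have "(x $ 1)\<^sup>2 + (x $ 2)\<^sup>2 = 1"
      by (simp add: inner_vec_def sum_2 power2_eq_square)
    then show ?thesis
      by (metis sincos_total_2pi)
  qed
  then obtain \<theta> where \<theta>: "\<And>x::real^2. x \<in> sphere 0 1 \<Longrightarrow> x $ 1 = cos (\<theta> x) \<and> x $ 2 = sin (\<theta> x)"
    by metis
  have "sphere_poly 1 k (x \<bullet> y) = sphere_poly 1 k 1 *
      (cos (real k * \<theta> x) * cos (real k * \<theta> y) + sin (real k * \<theta> x) * sin (real k * \<theta> y))"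
    if xy: "x \<in> sphere 0 1" "y \<in> sphere 0 1" for x y :: "real^2"
  proof (cases "k = 0")
    case False
    have "x \<bullet> y = cos (\<theta> x - \<theta> y)"
      using \<theta>[OF xy(1)] \<theta>[OF xy(2)] by (simp add: inner_vec_def sum_2 cos_diff)
    then have "sphere_poly 1 k (x \<bullet> y) = 2 / real k * cos (real k * (\<theta> x - \<theta> y))"
      using False sphere_poly_circle[of k "\<theta> x - \<theta> y"] by (simp only: Suc_leI neq0_conv One_nat_def)
    moreover have "sphere_poly 1 k 1 = 2 / real k"
      using False by (simp add: sphere_poly_def)
    ultimately show ?thesis
      by (simp only: right_diff_distrib cos_diff)
  qed (simp add: sphere_poly_def)
  then show ?thesis
    by (intro exI[of _ "\<lambda>x. cos (real k * \<theta> x)"] exI[of _ "\<lambda>x. sin (real k * \<theta> x)"] ballI)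
qed

text \<open>The kernel sees the points only through \<open>g\<close>, so the weights on each fibre
  can be summed. This turns forms on the product into forms at distinct points of
  \<open>S^m\<close>.\<close>

lemma quadratic_form_fibres:
  fixes w :: "'p \<Rightarrow> real"
  assumes "finite F"
  shows "(\<Sum>p\<in>F. \<Sum>q\<in>F. w p * w q * H (g p) (g q)) =
     (\<Sum>y\<in>g ` F. \<Sum>z\<in>g ` F. sum w {p \<in> F. g p = y} * sum w {p \<in> F. g p = z} * H y z)"
proof -
  have "(\<Sum>p\<in>F. \<Sum>q\<in>F. w p * w q * H (g p) (g q)) =
      (\<Sum>y\<in>g ` F. \<Sum>p | p \<in> F \<and> g p = y. \<Sum>z\<in>g ` F. \<Sum>q | q \<in> F \<and> g q = z. w p * w q * H (g p) (g q))"
    by (subst sum.image_gen[OF assms, of _ g], intro sum.cong refl, rule sum.image_gen[OF assms])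
  also have "\<dots> = (\<Sum>y\<in>g ` F. \<Sum>z\<in>g ` F. \<Sum>p | p \<in> F \<and> g p = y. \<Sum>q | q \<in> F \<and> g q = z. w p * w q * H (g p) (g q))"
    by (intro sum.cong refl sum.swap)
  also have "\<dots> = (\<Sum>y\<in>g ` F. \<Sum>z\<in>g ` F. sum w {p \<in> F. g p = y} * sum w {p \<in> F. g p = z} * H y z)"
    by (intro sum.cong refl, subst sum_product, unfold sum_distrib_right, intro sum.cong refl) auto
  finally show ?thesis .
qed

lemma has_sum_sum:
  fixes f :: "'i \<Rightarrow> 'a \<Rightarrow> 'b::topological_comm_monoid_add"
  assumes "\<And>i. i \<in> I \<Longrightarrow> (f i has_sum s i) A"
  shows "((\<lambda>x. \<Sum>i\<in>I. f i x) has_sum (\<Sum>i\<in>I. s i)) A"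
  using assms by (induction I rule: infinite_finite_induct) (simp_all add: has_sum_add)

theorem theorem2p4:
  fixes m :: nat
    and f :: "real \<Rightarrow> real \<Rightarrow> real"
  assumes "m \<ge> 2"
    and "CARD('n::finite) = m + 1"
    and "continuous_on ({-1..1} \<times> {-1..1}) (\<lambda>(t, s). f t s)"
    and "pos_def_on (sphere (0 :: real^2) 1 \<times> sphere (0 :: real^'n) 1)
           (\<lambda>(x, z) (y, w). f (x \<bullet> y) (z \<bullet> w))"
    and "{k. {l. (k, l) \<in> product_support m f} \<in> SPD_sphere TYPE('n)} \<in> SPD_sphere TYPE(2)"
  shows "strictly_pos_def_on (sphere (0 :: real^2) 1 \<times> sphere (0 :: real^'n) 1)
           (\<lambda>(x, z) (y, w). f (x \<bullet> y) (z \<bullet> w))"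
proof (rule strictly_pos_def_onI[OF assms(4)])
  fix F :: "((real^2) \<times> (real^'n)) set" and c
  assume F: "finite F" "F \<subseteq> sphere 0 1 \<times> sphere 0 1"
    and "(\<Sum>p\<in>F. \<Sum>q\<in>F. c p * c q * (case p of (x, z) \<Rightarrow> \<lambda>(y, w). f (x \<bullet> y) (z \<bullet> w)) q) = 0"
  then have zero: "(\<Sum>p\<in>F. \<Sum>q\<in>F. c p * c q * f (fst p \<bullet> fst q) (snd p \<bullet> snd q)) = 0"
    by (simp add: split_beta)
  have card: "CARD('n) = Suc m" "CARD(2) = Suc 1" and "m \<ge> 1"
    using assms(1,2) by simp_all
  interpret round_sphere "axis undefined 1 :: real^'n" m
    using card(1) \<open>m \<ge> 1\<close> by (rule round_sphere_vec)
  have Fs: "fst p \<in> sphere 0 1" "snd p \<in> sphere 0 1" if "p \<in> F" for p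
    using F(2) that by auto
  obtain C S where CS: "\<And>k x y. x \<in> sphere (0::real^2) 1 \<Longrightarrow> y \<in> sphere 0 1 \<Longrightarrow>
     sphere_poly 1 k (x \<bullet> y) = sphere_poly 1 k 1 * (C k x * C k y + S k x * S k y)"
    using circle_poly_split by metis
  have P1: "sphere_poly 1 k 1 > 0" for k
    by (rule sphere_poly_at_1_pos) simp
  \<comment> \<open>The circle factor is absorbed into the weights, with one family for each summand
    of the addition formula.\<close>
  define wC wS where "wC k p = c p * C k (fst p)" and "wS k p = c p * S k (fst p)" for k p
  define Z where "Z w l = (\<Sum>p\<in>F. \<Sum>q\<in>F. w p * w q * sphere_poly m l (snd p \<bullet> snd q))"
    for l and w :: "(real^2) \<times> (real^'n) \<Rightarrow> real"
  \<comment> \<open>Several points of \<open>F\<close> may share their second component; strictness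
    on \<open>S^m\<close> concerns distinct points and so sees only these fibre sums.\<close>
  define W where "W w z = sum w {p \<in> F. snd p = z}"
    for z and w :: "(real^2) \<times> (real^'n) \<Rightarrow> real"
  have Z_fibre: "Z w l = (\<Sum>y\<in>snd ` F. \<Sum>z\<in>snd ` F. W w y * W w z * sphere_poly m l (y \<bullet> z))" for w l
    unfolding Z_def W_def by (rule quadratic_form_fibres[OF F(1)])
  have sndF: "finite (snd ` F)" "snd ` F \<subseteq> sphere 0 1"
    using F(1) Fs(2) by auto
  have Z_nonneg: "Z w l \<ge> 0" for w l
    unfolding Z_fibre by (rule psd_onD[OF psd_on_sphere_poly sndF])
  have Q: "(\<Sum>p\<in>F. \<Sum>q\<in>F. c p * c q * (sphere_poly 1 k (fst p \<bullet> fst q) * sphere_poly m l (snd p \<bullet> snd q))) =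
      sphere_poly 1 k 1 * (Z (wC k) l + Z (wS k) l)" for k l
    unfolding Z_def sum.distrib[symmetric] sum_distrib_left
    by (intro sum.cong refl, subst CS) (simp_all add: Fs[simplified] wC_def wS_def algebra_simps)
  have Z_zero: "Z (wC k) l = 0 \<and> Z (wS k) l = 0" if kl: "(k, l) \<in> product_support m f" for k l
  proof -
    obtain a where a: "product_coeffs m f a" "a k l > 0"
      using kl by (auto simp: product_support_def)
    have "((\<lambda>kl. \<Sum>p\<in>F. \<Sum>q\<in>F. c p * c q *
        (case kl of (k, l) \<Rightarrow> a k l * sphere_poly 1 k (fst p \<bullet> fst q) * sphere_poly m l (snd p \<bullet> snd q)))
        has_sum (\<Sum>p\<in>F. \<Sum>q\<in>F. c p * c q * f (fst p \<bullet> fst q) (snd p \<bullet> snd q))) UNIV"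
    proof (intro has_sum_sum has_sum_cmult_right)
      fix p q assume "p \<in> F" "q \<in> F"
      then have "fst p \<bullet> fst q \<in> {-1..1}" "snd p \<bullet> snd q \<in> {-1..1}"
        using Fs[of p] Fs[of q] by (simp_all only: mem_sphere_0 inner_sphere_range)
      then show "((\<lambda>kl. case kl of (k, l) \<Rightarrow> a k l * sphere_poly 1 k (fst p \<bullet> fst q) * sphere_poly m l (snd p \<bullet> snd q))
          has_sum f (fst p \<bullet> fst q) (snd p \<bullet> snd q)) UNIV"
        using a(1) by (simp add: product_coeffs_def)
    qed
    moreover have "(\<Sum>p\<in>F. \<Sum>q\<in>F. c p * c q *
        (case kl of (k, l) \<Rightarrow> a k l * sphere_poly 1 k (fst p \<bullet> fst q) * sphere_poly m l (snd p \<bullet> snd q))) =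
        (case kl of (k, l) \<Rightarrow> a k l * (sphere_poly 1 k 1 * (Z (wC k) l + Z (wS k) l)))" for kl
      unfolding Q[symmetric] sum_distrib_left by (cases kl) (simp add: mult_ac)
    ultimately have "((\<lambda>kl. case kl of (k, l) \<Rightarrow> a k l * (sphere_poly 1 k 1 * (Z (wC k) l + Z (wS k) l)))
        has_sum 0) UNIV"
      using zero by simp
    \<comment> \<open>A sum of nonnegative terms with value zero has only zero terms; the one at
      \<open>(k, l)\<close> carries a positive coefficient.\<close>
    then have "(case (k, l) of (k, l) \<Rightarrow> a k l * (sphere_poly 1 k 1 * (Z (wC k) l + Z (wS k) l))) = 0"
    proof (rule nonneg_has_sum_le_0D)
      fix kl :: "nat \<times> nat"
      show "(case kl of (k, l) \<Rightarrow> a k l * (sphere_poly 1 k 1 * (Z (wC k) l + Z (wS k) l))) \<ge> 0"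
        using a(1) Z_nonneg P1 by (cases kl) (simp add: product_coeffs_def less_imp_le)
    qed simp_all
    then have "Z (wC k) l + Z (wS k) l = 0"
      using a(2) P1[of k] by simp
    then show ?thesis
      using Z_nonneg[of "wC k" l] Z_nonneg[of "wS k" l] by linarith
  qed
  \<comment> \<open>For such \<open>k\<close> the forms of the fibre sums vanish for every
    \<open>l\<close> in a set belonging to \<open>SPD(S^m)\<close>.\<close>
  have W_zero: "W (wC k) z = 0 \<and> W (wS k) z = 0"
    if k: "{l. (k, l) \<in> product_support m f} \<in> SPD_sphere TYPE('n)" and z: "z \<in> snd ` F" for k z
    using SPD_sphere_vanishing[OF card(1) \<open>m \<ge> 1\<close> k sndF _ z, of "W (wC k)"]
      SPD_sphere_vanishing[OF card(1) \<open>m \<ge> 1\<close> k sndF _ z, of "W (wS k)"] Z_zero[of k]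
    by (simp add: Z_fibre)
  show "\<forall>p\<in>F. c p = 0"
  proof
    fix p assume p: "p \<in> F"
    \<comment> \<open>The circle components of the points of \<open>F\<close> over the same point of
      \<open>S^m\<close> as \<open>p\<close>; within this fibre they determine the points.\<close>
    define G where "G = {x. (x, snd p) \<in> F}"
    have G_eq: "{q \<in> F. snd q = snd p} = (\<lambda>x. (x, snd p)) ` G"
      by (force simp: G_def)
    have G: "finite G" "G \<subseteq> sphere 0 1"
    proof -
      have "G \<subseteq> fst ` F" by (force simp: G_def)
      then show "finite G" "G \<subseteq> sphere 0 1"
        using F(1) Fs(1) by (auto intro: finite_subset)
    qed
    have W_G: "W w (snd p) = (\<Sum>x\<in>G. w (x, snd p))" for w
      unfolding W_def G_eq by (subst sum.reindex) (auto intro: inj_onI)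
    \<comment> \<open>On this fibre the form is a multiple of the sum of the squares of the two
      fibre sums, which vanish. As this holds for every admissible \<open>k\<close>, strictness on
      \<open>S^1\<close> applies.\<close>
    have "(\<Sum>x\<in>G. \<Sum>y\<in>G. c (x, snd p) * c (y, snd p) * sphere_poly 1 k (x \<bullet> y)) = 0"
      if k: "{l. (k, l) \<in> product_support m f} \<in> SPD_sphere TYPE('n)" for k
    proof -
      have "(\<Sum>x\<in>G. \<Sum>y\<in>G. c (x, snd p) * c (y, snd p) * sphere_poly 1 k (x \<bullet> y)) =
        (\<Sum>x\<in>G. \<Sum>y\<in>G. sphere_poly 1 k 1 *
          (wC k (x, snd p) * wC k (y, snd p) + wS k (x, snd p) * wS k (y, snd p)))"
        using G(2) by (intro sum.cong refl, subst CS) (auto simp: wC_def wS_def algebra_simps)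
      also have "\<dots> = sphere_poly 1 k 1 *
          ((\<Sum>x\<in>G. wC k (x, snd p))\<^sup>2 + (\<Sum>x\<in>G. wS k (x, snd p))\<^sup>2)"
        by (simp only: sum_product_square[symmetric] sum.distrib[symmetric] sum_distrib_left)
      also have "\<dots> = 0"
        using W_zero[OF k imageI[OF p]] by (simp add: W_G)
      finally show ?thesis .
    qed
    then have "c (fst p, snd p) = 0"
      using SPD_sphere_vanishing[OF card(2) order.refl assms(5) G, of "\<lambda>x. c (x, snd p)" "fst p"] p
      by (simp add: G_def)
    then show "c p = 0" by simp
  qed
qed

end
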